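(* Assume that $$T_t=I+tS+\frac{t^2}{2}R+o(t^2),\qquad t\to0,$$ uniformly on $\Omega$, where $I$ is the identity mapping and $S,R:\Omega\to\mathbb{R}^n$ are Lipschitz continuous vector fields. Let $k\ge1$ be such that $\lambda_{k-1}(0)<\lambda_k(0)<\lambda_{k+1}(0)$ (with $\lambda_0(0)=-\infty$), let $\phi=u_k(0)$ be the normalized $k$-th eigenfunction at $t=0$, and put $\dot A=\dot A_0(\phi,\phi)$, $\ddot A=\ddot A_0(\phi,\phi)$, $\dot B=\dot B_0(\phi,\phi)$, $\ddot B=\ddot B_0(\phi,\phi)$. Then $$\dot A=\int_\Omega\bigl(-(DS^T+DS)+(\nabla\cdot S)E\bigr)[\nabla\phi,\nabla\phi]\,dx,$$ $$\ddot A=\int_\Omega\Bigl((2(DS)^2-DR)^T+(2(DS)^2-DR)+2(DS)(DS)^T-2(\nabla\cdot S)(DS^T+DS)+\bigl(\nabla\cdot R+(\nabla\cdot S)^2-DS^T:DS\bigr)E\Bigr)[\nabla\phi,\nabla\phi]\,dx,$$ $$\dot B=\int_\Omega(\nabla\cdot S)\phi^2\,dx,\qquad \ddot B=\int_\Omega\bigl(\nabla\cdot R+(\nabla\cdot S)^2-DS^T:DS\bigr)\phi^2\,dx.$$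
   Context: $\Omega\subset\mathbb{R}^n$, $n\ge2$, is a bounded Lipschitz domain whose boundary is divided into disjoint relatively open sets $\gamma_0,\gamma_1$ with $\overline{\gamma_0}\cup\overline{\gamma_1}=\partial\Omega$ and $\overline{\gamma_0}\cap\overline{\gamma_1}=\emptyset$. Let $X=L^2(\Omega)$ and $V=\{v\in H^1(\Omega): v|_{\gamma_0}=0\}$ (trace sense). $T_t:\Omega\to\Omega_t=T_t(\Omega)$, $t\in(-\varepsilon_0,\varepsilon_0)$, is a family of bi-Lipschitz homeomorphisms, with $T_tx$ continuous in $t$ uniformly in $x\in\Omega$, which is twice continuously differentiable in the following sense: $T_tx$ is twice differentiable in $t$ for every $x\in\Omega$; for $0\le\ell\le2$ the maps $\partial_t^\ell DT_t$ and $\partial_t^\ell (DT_t)^{-1}$ from $\Omega$ to the real $n\times n$ matrices are bounded uniformly in $(x,t)$; and they are continuous in $t$ as maps into $L^\infty(\Omega)$. Here $DT_t$ is the Jacobi matrix. Put $a_t=\det DT_t$ and $Q_t=(DT_t)^{-1}\bigl((DT_t)^{-1}\bigr)^T$, and $$A_t(u,v)=\int_\Omega Q_t[\nabla u,\nabla v]\,a_t\,dx\ (u,v\in V),\qquad B_t(u,v)=\int_\Omega uv\,a_t\,dx\ (u,v\in X),$$ $$\dot A_t(u,v)=\int_\Omega\partial_t\bigl(Q_t[\nabla u,\nabla v]a_t\bigr)dx,\quad \ddot A_t(u,v)=\int_\Omega\partial_t^2\bigl(Q_t[\nabla u,\nabla v]a_t\bigr)dx,$$ $$\dot B_t(u,v)=\int_\Omega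 uv\,\partial_ta_t\,dx,\quad \ddot B_t(u,v)=\int_\Omega uv\,\partial_t^2a_t\,dx.$$ $\lambda_1(t)\le\lambda_2(t)\le\cdots$ are the eigenvalues (with multiplicity) of: $u\in V$, $B_t(u,u)=1$, $A_t(u,v)=\lambda B_t(u,v)$ for all $v\in V$, with $B_t$-orthonormal eigenfunctions $u_1(t),u_2(t),\dots$. (This is the weak form, pulled back to $\Omega$, of $-\Delta u=\lambda u$ in $\Omega_t$, $u=0$ on $T_t(\gamma_0)$, $\partial u/\partial\nu=0$ on $T_t(\gamma_1)$.) Notation: $G[\xi,\eta]=\xi^TG\eta$ for a matrix $G$; $E$ is the unit matrix; $G:F=\sum_{i,j}g_{ij}f_{ij}$; $DS=(\partial S^i/\partial x_j)_{ij}$ and $DR$ are Jacobi matrices; $DS^T$ is the transpose of $DS$. *)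

theory Defs
  imports "HOL-Analysis.Analysis" "HOL-Probability.Essential_Supremum"
begin

abbreviation Jac :: "(real^'n \<Rightarrow> real^'n) \<Rightarrow> real^'n \<Rightarrow> real^'n^'n" where
  "Jac F x \<equiv> jacobian F (at x)"

definition divergence :: "(real^'n \<Rightarrow> real^'n) \<Rightarrow> real^'n \<Rightarrow> real" where
  "divergence F x = trace (Jac F x)"

definition bilin :: "real^'n^'n \<Rightarrow> real^'n \<Rightarrow> real^'n \<Rightarrow> real" where
  "bilin G \<xi> \<eta> = \<xi> \<bullet> (G *v \<eta>)"

definition frobenius :: "real^'n^'n \<Rightarrow> real^'n^'n \<Rightarrow> real" where
  "frobenius G F = (\<Sum>i\<in>UNIV. \<Sum>j\<in>UNIV. G $ i $ j * F $ i $ j)"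

text \<open>
  Near each boundary point the domain is the strict supergraph, in some unit direction
  \<open>\<nu>\<close>, of a Lipschitz function on the hyperplane orthogonal to \<open>\<nu>\<close>. That the
  boundary is locally the graph itself follows, since \<open>U\<close> is open.
\<close>

definition lipschitz_domain :: "(real^'n) set \<Rightarrow> bool" where
  "lipschitz_domain \<Omega> \<longleftrightarrow> open \<Omega> \<and> connected \<Omega> \<and> \<Omega> \<noteq> {} \<and>
     (\<forall>p\<in>frontier \<Omega>. \<exists>U \<nu> g L. open U \<and> p \<in> U \<and> norm \<nu> = 1 \<and>
        L-lipschitz_on {y. y \<bullet> \<nu> = 0} g \<and>
        \<Omega> \<inter> U = {x\<in>U. g (x - (x \<bullet> \<nu>) *\<^sub>R \<nu>) < x \<bullet> \<nu>})"

definition boundary_partition :: "(real^'n) set \<Rightarrow> (real^'n) set \<Rightarrow> (real^'n) set \<Rightarrow> bool" where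
  "boundary_partition \<Omega> \<gamma>\<^sub>0 \<gamma>\<^sub>1 \<longleftrightarrow>
     openin (top_of_set (frontier \<Omega>)) \<gamma>\<^sub>0 \<and> openin (top_of_set (frontier \<Omega>)) \<gamma>\<^sub>1 \<and>
     \<gamma>\<^sub>0 \<inter> \<gamma>\<^sub>1 = {} \<and>
     closure \<gamma>\<^sub>0 \<union> closure \<gamma>\<^sub>1 = frontier \<Omega> \<and> closure \<gamma>\<^sub>0 \<inter> closure \<gamma>\<^sub>1 = {}"

text \<open>
  Elements of these spaces are represented by functions on the whole space, of which only
  the values almost everywhere on \<open>\<Omega>\<close> matter.
\<close>

definition L2 :: "(real^'n) set \<Rightarrow> (real^'n \<Rightarrow> 'b::euclidean_space) set" where
  "L2 \<Omega> = {f \<in> borel_measurable (lebesgue_on \<Omega>).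
             integrable (lebesgue_on \<Omega>) (\<lambda>x. (norm (f x))\<^sup>2)}"

definition Linf_norm :: "(real^'n) set \<Rightarrow> (real^'n \<Rightarrow> 'b::real_normed_vector) \<Rightarrow> ereal" where
  "Linf_norm \<Omega> f = esssup (lebesgue_on \<Omega>) (\<lambda>x. ereal (norm (f x)))"

definition partial :: "'n \<Rightarrow> (real^'n \<Rightarrow> real) \<Rightarrow> real^'n \<Rightarrow> real" where
  "partial i f x = frechet_derivative f (at x) (axis i 1)"

primrec times_cont_diff :: "nat \<Rightarrow> (real^'n \<Rightarrow> real) \<Rightarrow> bool" where
  "times_cont_diff 0 f \<longleftrightarrow> continuous_on UNIV f"
| "times_cont_diff (Suc k) f \<longleftrightarrow>
     (\<forall>x. f differentiable (at x)) \<and> (\<forall>i. times_cont_diff k (partial i f))"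

definition smooth :: "(real^'n \<Rightarrow> real) \<Rightarrow> bool" where
  "smooth f \<longleftrightarrow> (\<forall>k. times_cont_diff k f)"

definition test_function :: "(real^'n) set \<Rightarrow> (real^'n \<Rightarrow> real) \<Rightarrow> bool" where
  "test_function \<Omega> \<psi> \<longleftrightarrow> smooth \<psi> \<and> (\<exists>K. compact K \<and> K \<subseteq> \<Omega> \<and> (\<forall>x. x \<notin> K \<longrightarrow> \<psi> x = 0))"

definition has_weak_grad ::
  "(real^'n) set \<Rightarrow> (real^'n \<Rightarrow> real) \<Rightarrow> (real^'n \<Rightarrow> real^'n) \<Rightarrow> bool" where
  "has_weak_grad \<Omega> u g \<longleftrightarrow> (\<forall>\<psi> i. test_function \<Omega> \<psi> \<longrightarrow>
     (LINT x|lebesgue_on \<Omega>. u x * partial i \<psi> x) = - (LINT x|lebesgue_on \<Omega>. g x $ i * \<psi> x))"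

definition H1 :: "(real^'n) set \<Rightarrow> (real^'n \<Rightarrow> real) set" where
  "H1 \<Omega> = {u \<in> L2 \<Omega>. \<exists>g\<in>L2 \<Omega>. has_weak_grad \<Omega> u g}"

text \<open>For \<open>u \<in> H1 \<Omega>\<close> the weak gradient is unique up to null sets.\<close>

definition grad :: "(real^'n) set \<Rightarrow> (real^'n \<Rightarrow> real) \<Rightarrow> real^'n \<Rightarrow> real^'n" where
  "grad \<Omega> u = (SOME g. g \<in> L2 \<Omega> \<and> has_weak_grad \<Omega> u g)"

definition H1_norm :: "(real^'n) set \<Rightarrow> (real^'n \<Rightarrow> real) \<Rightarrow> real" where
  "H1_norm \<Omega> u = sqrt ((LINT x|lebesgue_on \<Omega>. (u x)\<^sup>2) + (LINT x|lebesgue_on \<Omega>. (norm (grad \<Omega> u x))\<^sup>2))"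

text \<open>
  The \<open>m\<close>-dimensional Hausdorff measure, normalised so as to agree with surface measure.
  The set function \<open>hausdorff_outer m\<close> is a metric outer measure, hence countably additive on
  the Borel sets. Only \<open>m \<ge> 1\<close> is used; for \<open>m = 0\<close> the empty set would need a
  separate convention in the covering sum.
\<close>

definition hausdorff_pre :: "nat \<Rightarrow> real \<Rightarrow> (real^'n) set \<Rightarrow> ennreal" where
  "hausdorff_pre m \<delta> A =
     Inf {(\<Sum>i. ennreal (unit_ball_vol (real m) * (diameter (C i) / 2) ^ m)) | C :: nat \<Rightarrow> (real^'n) set.
            A \<subseteq> (\<Union>i. C i) \<and> (\<forall>i. bounded (C i) \<and> diameter (C i) \<le> \<delta>)}"

definition hausdorff_outer :: "nat \<Rightarrow> (real^'n) set \<Rightarrow> ennreal" where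
  "hausdorff_outer m A = (SUP \<delta>\<in>{0<..}. hausdorff_pre m \<delta> A)"

definition hausdorff_measure :: "nat \<Rightarrow> (real^'n) measure" where
  "hausdorff_measure m = measure_of UNIV (sets borel) (hausdorff_outer m)"

definition surface_measure :: "(real^'n) set \<Rightarrow> (real^'n) measure" where
  "surface_measure \<Omega> = restrict_space (hausdorff_measure (CARD('n) - 1)) (frontier \<Omega>)"

text \<open>
  The graph of the trace operator: the continuous extension to \<open>H1 \<Omega>\<close>, with values in
  \<open>L2\<close> of the boundary, of the restriction \<open>w \<mapsto> w\<close> to \<open>frontier \<Omega>\<close> of functions \<open>w\<close> that are
  smooth up to the boundary (which are dense in \<open>H1 \<Omega>\<close> for a bounded Lipschitz domain).
\<close>

definition has_trace ::
  "(real^'n) set \<Rightarrow> (real^'n \<Rightarrow> real) \<Rightarrow> (real^'n \<Rightarrow> real) \<Rightarrow> bool" where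
  "has_trace \<Omega> v g \<longleftrightarrow> v \<in> H1 \<Omega> \<and> g \<in> borel_measurable (surface_measure \<Omega>) \<and>
     (\<exists>w. (\<forall>j. smooth (w j)) \<and>
          (\<lambda>j. H1_norm \<Omega> (\<lambda>x. w j x - v x)) \<longlonglongrightarrow> 0 \<and>
          (\<lambda>j. \<integral>\<^sup>+ y. ennreal ((w j y - g y)\<^sup>2) \<partial>surface_measure \<Omega>) \<longlonglongrightarrow> 0)"

definition V_space :: "(real^'n) set \<Rightarrow> (real^'n) set \<Rightarrow> (real^'n \<Rightarrow> real) set" where
  "V_space \<Omega> \<gamma>\<^sub>0 = {v \<in> H1 \<Omega>. \<exists>g. has_trace \<Omega> v g \<and> (AE y in surface_measure \<Omega>. y \<in> \<gamma>\<^sub>0 \<longrightarrow> g y = 0)}"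

definition partial_t :: "(real \<Rightarrow> 'a \<Rightarrow> 'b::real_normed_vector) \<Rightarrow> real \<Rightarrow> 'a \<Rightarrow> 'b" where
  "partial_t F t x = vector_derivative (\<lambda>s. F s x) (at t)"

text \<open>
  \<open>C2_Linf \<epsilon> \<Omega> F\<close>: the \<open>t\<close>-derivatives of order \<open>\<le> 2\<close> of \<open>F\<close> exist for
  \<open>\<bar>t\<bar> < \<epsilon>\<close> at almost every \<open>x \<in> \<Omega>\<close>, are bounded uniformly in \<open>(x, t)\<close> and continuous in \<open>t\<close> as
  maps into \<open>L\<^sup>\<infinity>(\<Omega>)\<close>. That the null set does not depend on \<open>t\<close> is no restriction: a \<open>C\<^sup>2\<close> map
  into \<open>L\<^sup>\<infinity>(\<Omega>)\<close> has such a representative, as one sees from rational \<open>t\<close>.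
\<close>

definition C2_Linf :: "real \<Rightarrow> (real^'n) set \<Rightarrow> (real \<Rightarrow> real^'n \<Rightarrow> 'b::real_normed_vector) \<Rightarrow> bool" where
  "C2_Linf \<epsilon> \<Omega> F \<longleftrightarrow>
     (\<forall>l<2. AE x in lebesgue_on \<Omega>. \<forall>t\<in>{-\<epsilon><..<\<epsilon>}. (\<lambda>s. (partial_t ^^ l) F s x) differentiable (at t)) \<and>
     (\<forall>l\<le>2. \<forall>t\<in>{-\<epsilon><..<\<epsilon>}. (partial_t ^^ l) F t \<in> borel_measurable (lebesgue_on \<Omega>)) \<and>
     (\<exists>M::real. \<forall>l\<le>2. \<forall>t\<in>{-\<epsilon><..<\<epsilon>}. Linf_norm \<Omega> ((partial_t ^^ l) F t) \<le> ereal M) \<and>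
     (\<forall>l\<le>2. \<forall>t\<in>{-\<epsilon><..<\<epsilon>}.
        ((\<lambda>s. Linf_norm \<Omega> (\<lambda>x. (partial_t ^^ l) F s x - (partial_t ^^ l) F t x)) \<longlongrightarrow> 0) (at t))"

definition bilipschitz_homeomorphism :: "(real^'n) set \<Rightarrow> (real^'n \<Rightarrow> real^'n) \<Rightarrow> bool" where
  "bilipschitz_homeomorphism \<Omega> F \<longleftrightarrow>
     (\<exists>G L. homeomorphism \<Omega> (F ` \<Omega>) F G \<and> L-lipschitz_on \<Omega> F \<and> L-lipschitz_on (F ` \<Omega>) G)"

text \<open>
  The fourth condition records that the Jacobi matrices exist almost everywhere (for each
  \<open>t\<close> this is Rademacher's theorem; the common null set is justified as above).
\<close>

definition C2_family :: "real \<Rightarrow> (real^'n) set \<Rightarrow> (real \<Rightarrow> real^'n \<Rightarrow> real^'n) \<Rightarrow> bool" where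
  "C2_family \<epsilon> \<Omega> T \<longleftrightarrow>
     (\<forall>t\<in>{-\<epsilon><..<\<epsilon>}. bilipschitz_homeomorphism \<Omega> (T t)) \<and>
     (\<forall>t\<in>{-\<epsilon><..<\<epsilon>}. uniform_limit \<Omega> T (T t) (at t)) \<and>
     (\<forall>l<2. \<forall>x\<in>\<Omega>. \<forall>t\<in>{-\<epsilon><..<\<epsilon>}. (\<lambda>s. (partial_t ^^ l) T s x) differentiable (at t)) \<and>
     (AE x in lebesgue_on \<Omega>. \<forall>t\<in>{-\<epsilon><..<\<epsilon>}. T t differentiable (at x)) \<and>
     C2_Linf \<epsilon> \<Omega> (\<lambda>t x. Jac (T t) x) \<and>
     C2_Linf \<epsilon> \<Omega> (\<lambda>t x. matrix_inv (Jac (T t) x))"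

definition vol :: "(real \<Rightarrow> real^'n \<Rightarrow> real^'n) \<Rightarrow> real \<Rightarrow> real^'n \<Rightarrow> real" where
  "vol T t x = det (Jac (T t) x)"

definition Qmat :: "(real \<Rightarrow> real^'n \<Rightarrow> real^'n) \<Rightarrow> real \<Rightarrow> real^'n \<Rightarrow> real^'n^'n" where
  "Qmat T t x = matrix_inv (Jac (T t) x) ** transpose (matrix_inv (Jac (T t) x))"

definition A_integrand :: "(real^'n) set \<Rightarrow> (real \<Rightarrow> real^'n \<Rightarrow> real^'n) \<Rightarrow>
    (real^'n \<Rightarrow> real) \<Rightarrow> (real^'n \<Rightarrow> real) \<Rightarrow> real \<Rightarrow> real^'n \<Rightarrow> real" where
  "A_integrand \<Omega> T u v t x = bilin (Qmat T t x) (grad \<Omega> u x) (grad \<Omega> v x) * vol T t x"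

definition A_form where
  "A_form \<Omega> T t u v = (LINT x|lebesgue_on \<Omega>. A_integrand \<Omega> T u v t x)"

definition A_dot where
  "A_dot \<Omega> T t u v = (LINT x|lebesgue_on \<Omega>. partial_t (A_integrand \<Omega> T u v) t x)"

definition A_ddot where
  "A_ddot \<Omega> T t u v = (LINT x|lebesgue_on \<Omega>. (partial_t ^^ 2) (A_integrand \<Omega> T u v) t x)"

definition B_form where
  "B_form \<Omega> T t u v = (LINT x|lebesgue_on \<Omega>. u x * v x * vol T t x)"

definition B_dot where
  "B_dot \<Omega> T t u v = (LINT x|lebesgue_on \<Omega>. u x * v x * partial_t (vol T) t x)"

definition B_ddot where
  "B_ddot \<Omega> T t u v = (LINT x|lebesgue_on \<Omega>. u x * v x * (partial_t ^^ 2) (vol T) t x)"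

definition eigenpair where
  "eigenpair \<Omega> \<gamma>\<^sub>0 T t \<mu> w \<longleftrightarrow> w \<in> V_space \<Omega> \<gamma>\<^sub>0 \<and>
     (\<forall>v\<in>V_space \<Omega> \<gamma>\<^sub>0. A_form \<Omega> T t w v = \<mu> * B_form \<Omega> T t w v)"

text \<open>
  \<open>\<lambda>\<^sub>1 \<le> \<lambda>\<^sub>2 \<le> \<dots>\<close> lists the eigenvalues with multiplicity and \<open>u\<^sub>1, u\<^sub>2, \<dots>\<close> are orthonormal
  eigenfunctions (index \<open>0\<close> is not used). The last clause says that no eigenvalue is missing
  and that the listed multiplicity is the dimension of the eigenspace.
\<close>

definition eigensystem where
  "eigensystem \<Omega> \<gamma>\<^sub>0 T t lam u \<longleftrightarrow>
     (\<forall>i\<ge>1. \<forall>j\<ge>i. lam i \<le> lam j) \<and>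
     (\<forall>i\<ge>1. eigenpair \<Omega> \<gamma>\<^sub>0 T t (lam i) (u i)) \<and>
     (\<forall>i\<ge>1. \<forall>j\<ge>1. B_form \<Omega> T t (u i) (u j) = (if i = j then 1 else 0)) \<and>
     (\<forall>\<mu> w. eigenpair \<Omega> \<gamma>\<^sub>0 T t \<mu> w \<longrightarrow>
        (\<exists>F c. finite F \<and> F \<subseteq> {i::nat. 1 \<le> i \<and> lam i = \<mu>} \<and>
               (AE x in lebesgue_on \<Omega>. w x = (\<Sum>i\<in>F. c i * u i x))))"

end

theory Submission
  imports Defs
begin

text \<open>
  All four identities hold because the integrands agree almost everywhere. Fix \<open>x\<close> and write
  \<open>M t\<close> for the Jacobi matrix of \<open>T t\<close> at \<open>x\<close>. If \<open>M 0 = E\<close>, \<open>M' 0 = DS\<close> and \<open>M'' 0 = DR\<close>, then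
  differentiating \<open>M N = E\<close> twice gives \<open>N' 0 = - DS\<close> and \<open>N'' 0 = 2 (DS)\<^sup>2 - DR\<close> for \<open>N = M\<^sup>-\<^sup>1\<close>, and
  Jacobi's formula \<open>(det M)' = det M * trace (N M')\<close> gives the first two derivatives
  \<open>div S\<close> and \<open>div R + (div S)\<^sup>2 - trace ((DS)\<^sup>2)\<close> of the determinant. The product rule for \<open>N N\<^sup>T det M\<close> then yields
  the stated integrands; this is \<open>partial_t_of_metric_and_volume\<close>.
  
  The analytic content is that the derivatives in \<open>t\<close> and in \<open>x\<close> commute at \<open>t = 0\<close>, which is
  \<open>AE_Jac_of_second_order_expansion\<close>. The expansion says that the difference quotients
  \<open>(T t - I) / t\<close> and \<open>2 (T t - I - t S) / t\<^sup>2\<close> converge to \<open>S\<close> and \<open>R\<close>, while the \<open>C\<^sup>2\<close> hypothesis on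
  \<open>M\<close> says that their Jacobi matrices converge in \<open>L\<^sup>\<infinity>\<close> to \<open>M' 0\<close> and \<open>M'' 0\<close>. Two facts turn this into
  the pointwise statement.
  
  \<^item> A Lipschitz map on a convex open set whose derivative is bounded by \<open>e\<close> almost everywhere is
    \<open>e\<close>-Lipschitz (\<open>norm_diff_le_of_AE_onorm_derivative_le\<close>). Hence \<open>L\<^sup>\<infinity>\<close> convergence of the derivatives
    is local convergence in the Lipschitz seminorm, under which differentiability at a point passes to
    the limit (\<open>AE_has_derivative_of_Linf_limit\<close>). In this way \<open>S\<close> and \<open>R\<close> inherit differentiability almost
    everywhere from the maps \<open>T t\<close>.
  
  \<^item> Continuity of \<open>\<partial>\<^sub>t M\<close> and \<open>\<partial>\<^sub>t\<^sup>2 M\<close> in \<open>L\<^sup>\<infinity>\<close> controls, for each \<open>t\<close>, their deviation from the values at \<open>0\<close>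
    off a null set depending on \<open>t\<close>. Fubini's theorem exchanges the quantifiers, after which the fundamental theorem of calculus in
    \<open>t\<close> gives Taylor estimates that hold for almost every \<open>x\<close> and all small \<open>t\<close> at once
    (\<open>AE_increment_le_of_Linf_derivative\<close>, \<open>C2_Linf_second_order\<close>).
\<close>

section \<open>Lipschitz maps with an almost everywhere bounded derivative\<close>

lemma has_vector_derivative_within_iff_slope:
  "(f has_vector_derivative D) (at s within S) \<longleftrightarrow>
     ((\<lambda>t. (1 / (t - s)) *\<^sub>R (f t - f s)) \<longlongrightarrow> D) (at s within S)"
proof -
  have "(f has_vector_derivative D) (at s within S) \<longleftrightarrow>
      ((\<lambda>t. norm ((f t - f s) - (t - s) *\<^sub>R D) / norm (t - s)) \<longlongrightarrow> 0) (at s within S)"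
    by (simp add: has_vector_derivative_def has_derivative_iff_norm bounded_linear_scaleR_left)
  also have "\<dots> \<longleftrightarrow> ((\<lambda>t. norm ((1 / (t - s)) *\<^sub>R (f t - f s) - D)) \<longlongrightarrow> 0) (at s within S)"
  proof (rule Lim_cong_within)
    fix t assume "t \<noteq> s"
    then have "(1 / (t - s)) *\<^sub>R (f t - f s) - D = (1 / (t - s)) *\<^sub>R ((f t - f s) - (t - s) *\<^sub>R D)"
      by (simp add: scaleR_diff_right)
    then show "norm ((f t - f s) - (t - s) *\<^sub>R D) / norm (t - s) = norm ((1 / (t - s)) *\<^sub>R (f t - f s) - D)"
      by simp
  qed auto
  finally show ?thesis by (simp add: tendsto_norm_zero_iff LIM_zero_iff)
qed

text \<open>
  Since the segment from \<open>x\<close> to \<open>y\<close> may lie in the exceptional set, \<open>f\<close> is averaged over translates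
  of the segment: \<open>\<Phi> s = \<integral>\<^bsub>K\<^esub> f (x + s (y - x) + z) dz\<close> over a small box \<open>K\<close>. For every single \<open>s\<close> almost all
  translates avoid the exceptional set, so dominated convergence, with the Lipschitz constant providing
  the majorant, gives \<open>\<Phi>'\<close> as the average of the derivatives. The mean value inequality bounds
  \<open>\<Phi> 1 - \<Phi> 0\<close>, and shrinking \<open>K\<close> to a point recovers \<open>f y - f x\<close>.
\<close>

lemma norm_diff_le_of_AE_onorm_derivative_le:
  fixes f :: "'a::euclidean_space \<Rightarrow> 'b::euclidean_space"
  assumes U: "open U" "convex U" and lip: "L-lipschitz_on U f"
    and N: "negligible N"
    and der: "\<And>p. p \<in> U - N \<Longrightarrow> (f has_derivative f' p) (at p)"
    and bnd: "\<And>p. p \<in> U - N \<Longrightarrow> onorm (f' p) \<le> e" and e: "0 \<le> e"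
    and xy: "x \<in> U" "y \<in> U"
  shows "norm (f y - f x) \<le> e * norm (y - x)"
proof -
  define v where "v = y - x"
  define seg where "seg = (\<lambda>s. x + s *\<^sub>R v) ` {0..1}"
  have L: "0 \<le> L" using lip by (rule lipschitz_on_nonneg)
  have "compact seg" unfolding seg_def by (intro compact_continuous_image continuous_intros) auto
  moreover have "seg \<subseteq> U"
    using U(2) xy unfolding seg_def v_def
    by (auto simp: convex_alt algebra_simps)
  ultimately obtain r where r: "r > 0" "(\<Union>p\<in>seg. cball p r) \<subseteq> U"
    using compact_subset_open_imp_cball_epsilon_subset[OF _ U(1)] by metis
  have inU: "x + s *\<^sub>R v + z \<in> U" if "s \<in> {0..1}" "norm z \<le> r" for s z
    using r(2) that unfolding seg_def by (force simp: dist_norm)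
  have key: "norm (f y - f x) \<le> e * norm v + 2 * L * \<rho>" if \<rho>: "0 < \<rho>" "\<rho> \<le> r" for \<rho>
  proof -
    obtain a b where ab: "0 \<in> box a b" "cbox a b \<subseteq> ball (0::'a) \<rho>"
      using open_contains_cbox[of "ball (0::'a) \<rho>"] \<rho>(1) by (metis centre_in_ball open_ball)
    define K where "K = cbox a b"
    have Kr: "norm z \<le> \<rho>" "norm z \<le> r" if "z \<in> K" for z
      using ab(2) that \<rho> unfolding K_def by (force simp: dist_norm)+
    have content: "measure lborel K > 0"
      unfolding K_def using ab(1) content_pos_lt_eq box_ne_empty by (metis empty_iff mem_box(1) order.strict_trans)
    define \<Phi> where "\<Phi> s = integral K (\<lambda>z. f (x + s *\<^sub>R v + z))" for s
    have int: "(\<lambda>z. f (x + s *\<^sub>R v + z)) integrable_on K" if "s \<in> {0..1}" for s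
      unfolding K_def
    proof (intro integrable_continuous continuous_on_compose2[OF lipschitz_on_continuous_on[OF lip]] continuous_intros)
      show "(\<lambda>z. x + s *\<^sub>R v + z) ` cbox a b \<subseteq> U" using inU that Kr unfolding K_def by auto
    qed
    have deriv: "\<exists>D. (\<Phi> has_vector_derivative D) (at s within {0..1}) \<and> norm D \<le> e * norm v * measure lborel K"
      if s: "s \<in> {0..1}" for s
    proof -
      define Ns where "Ns = (+) (- (x + s *\<^sub>R v)) ` N"
      have Ns: "negligible Ns" unfolding Ns_def by (rule negligible_translation[OF N])
      have notN: "x + s *\<^sub>R v + z \<notin> N" if "z \<notin> Ns" for z
        using that unfolding Ns_def image_iff by (metis add.commute add_minus_cancel)
      define g where "g z = (if z \<in> Ns then 0 else f' (x + s *\<^sub>R v + z) v)" for z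
      \<comment> \<open>Both the quotients and their limit are set to \<open>0\<close> on the null set, since convergence is needed everywhere on \<open>K\<close>.\<close>
      define q where "q t z = (if z \<in> Ns then 0 else
          (1 / (t - s)) *\<^sub>R (f (x + t *\<^sub>R v + z) - f (x + s *\<^sub>R v + z)))" for t z
      have gb: "norm (g z) \<le> e * norm v" if "z \<in> K" for z
      proof (cases "z \<in> Ns")
        case True then show ?thesis using e by (simp add: g_def)
      next
        case False
        then have p: "x + s *\<^sub>R v + z \<in> U - N" using inU s Kr that notN by auto
        have "norm (f' (x + s *\<^sub>R v + z) v) \<le> onorm (f' (x + s *\<^sub>R v + z)) * norm v"
          by (rule onorm[OF has_derivative_bounded_linear[OF der[OF p]]])
        also have "\<dots> \<le> e * norm v" by (intro mult_right_mono bnd[OF p]) auto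
        finally show ?thesis using False by (simp add: g_def)
      qed
      have qint: "((q t) has_integral (1 / (t - s)) *\<^sub>R (\<Phi> t - \<Phi> s)) K" if "t \<in> {0..1}" for t
      proof (rule has_integral_spike[OF Ns])
        show "((\<lambda>z. (1 / (t - s)) *\<^sub>R (f (x + t *\<^sub>R v + z) - f (x + s *\<^sub>R v + z)))
           has_integral (1 / (t - s)) *\<^sub>R (\<Phi> t - \<Phi> s)) K"
          unfolding \<Phi>_def by (intro has_integral_cmul has_integral_diff integrable_integral int that s)
      qed (simp add: q_def)
      have qb: "norm (q t z) \<le> L * norm v" if "t \<in> {0..1}" "t \<noteq> s" "z \<in> K" for t z
      proof -
        have "dist (f (x + t *\<^sub>R v + z)) (f (x + s *\<^sub>R v + z)) \<le> L * dist (x + t *\<^sub>R v + z) (x + s *\<^sub>R v + z)"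
          using that s inU Kr by (intro lipschitz_onD[OF lip]) auto
        also have "dist (x + t *\<^sub>R v + z) (x + s *\<^sub>R v + z) = \<bar>t - s\<bar> * norm v"
          by (simp add: dist_norm scaleR_diff_left[symmetric])
        finally show ?thesis using that(2) L
          by (auto simp: q_def dist_norm divide_simps mult_ac)
      qed
      have qlim: "((\<lambda>t. q t z) \<longlongrightarrow> g z) (at s within {0..1})" if "z \<in> K" for z
      proof (cases "z \<in> Ns")
        case True then show ?thesis by (simp add: q_def g_def)
      next
        case False
        have p: "x + s *\<^sub>R v + z \<in> U - N" using False inU s Kr that notN by auto
        have "((\<lambda>t. x + t *\<^sub>R v + z) has_derivative (\<lambda>h. h *\<^sub>R v)) (at s within {0..1})"
          by (auto intro!: derivative_eq_intros)
        then have "((\<lambda>t. f (x + t *\<^sub>R v + z)) has_derivative (\<lambda>h. f' (x + s *\<^sub>R v + z) (h *\<^sub>R v))) (at s within {0..1})"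
          using der[OF p] by (rule has_derivative_compose)
        then have "((\<lambda>t. f (x + t *\<^sub>R v + z)) has_vector_derivative f' (x + s *\<^sub>R v + z) v) (at s within {0..1})"
          using linear_scale[OF has_derivative_linear[OF der[OF p]]]
          by (simp add: has_vector_derivative_def)
        then show ?thesis using False
          by (simp add: has_vector_derivative_within_iff_slope q_def g_def)
      qed
      have lim: "(\<lambda>n. (1 / (t n - s)) *\<^sub>R (\<Phi> (t n) - \<Phi> s)) \<longlonglongrightarrow> integral K g" and gint: "g integrable_on K"
        if t: "\<And>n. t n \<in> {0..1} - {s}" "t \<longlonglongrightarrow> s" for t
      proof -
        have "(\<lambda>n. q (t n) z) \<longlonglongrightarrow> g z" if "z \<in> K" for z
          using qlim[OF that] t unfolding tendsto_at_iff_sequentially by (auto simp: o_def)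
        note dominated_convergence[of "\<lambda>n. q (t n)" K "\<lambda>_. L * norm v" g, OF _ _ _ this]
        moreover have "q (t n) integrable_on K" for n
          using qint[of "t n"] t(1)[of n] by (auto simp: integrable_on_def)
        moreover have "(\<lambda>z. L * norm v) integrable_on K" unfolding K_def by (rule integrable_const)
        ultimately show "(\<lambda>n. (1 / (t n - s)) *\<^sub>R (\<Phi> (t n) - \<Phi> s)) \<longlonglongrightarrow> integral K g" "g integrable_on K"
          using qb t(1) integral_unique[OF qint] by auto
      qed
      have lim': "((\<lambda>t. (1 / (t - s)) *\<^sub>R (\<Phi> t - \<Phi> s)) \<longlongrightarrow> integral K g) (at s within {0..1})"
        unfolding tendsto_at_iff_sequentially using lim by (auto simp: o_def)
      then have 1: "(\<Phi> has_vector_derivative integral K g) (at s within {0..1})"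
        by (simp add: has_vector_derivative_within_iff_slope)
      have "s islimpt {0..1::real}" using s by (simp add: islimpt_Icc)
      then obtain t where "\<And>n. t n \<in> {0..1} - {s}" "t \<longlonglongrightarrow> s"
        unfolding islimpt_sequential by auto
      from gint[OF this] have "norm (integral K g) \<le> integral K (\<lambda>_. e * norm v)"
        by (rule integral_norm_bound_integral) (auto simp: gb K_def)
      then have "norm (integral K g) \<le> e * norm v * measure lborel K"
        by (simp add: K_def mult_ac)
      with 1 show ?thesis by blast
    qed
    then obtain D where D: "\<And>s. s \<in> {0..1} \<Longrightarrow> (\<Phi> has_vector_derivative D s) (at s within {0..1})"
      "\<And>s. s \<in> {0..1} \<Longrightarrow> norm (D s) \<le> e * norm v * measure lborel K" by metis
    have "norm (\<Phi> 1 - \<Phi> 0) \<le> e * norm v * measure lborel K * norm (1 - 0::real)"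
    proof (rule differentiable_bound[where S="{0..1}" and f'="\<lambda>s h. h *\<^sub>R D s"])
      show "onorm (\<lambda>h. h *\<^sub>R D s) \<le> e * norm v * measure lborel K" if "s \<in> {0..1}" for s
        using D(2)[OF that] e content by (intro onorm_bound) (auto simp: mult.commute intro!: mult_left_mono)
    qed (use D(1) in \<open>auto simp: has_vector_derivative_def\<close>)
    \<comment> \<open>All translations in \<open>K\<close> are shorter than \<open>\<rho>\<close>, so averaging shifts each of \<open>f x\<close> and \<open>f y\<close> by at most \<open>L * \<rho>\<close>.\<close>
    moreover have "norm ((\<Phi> 1 - \<Phi> 0) - measure lborel K *\<^sub>R (f y - f x)) \<le> 2 * L * \<rho> * measure lborel K"
    proof -
      have i: "((\<lambda>z. f (x + 1 *\<^sub>R v + z) - f (x + 0 *\<^sub>R v + z) - (f y - f x)) has_integral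
         ((\<Phi> 1 - \<Phi> 0) - measure lborel K *\<^sub>R (f y - f x))) K"
        unfolding \<Phi>_def using has_integral_const[of "f y - f x" a b]
        by (intro has_integral_diff integrable_integral int) (auto simp: K_def)
      have "norm (f (x + 1 *\<^sub>R v + z) - f (x + 0 *\<^sub>R v + z) - (f y - f x)) \<le> 2 * L * \<rho>" if "z \<in> K" for z
      proof -
        have m: "y + z \<in> U" "x + z \<in> U" using inU[of 1 z] inU[of 0 z] Kr[OF that] by (auto simp: v_def)
        have "norm (f (y + z) - f y) \<le> L * norm z" "norm (f (x + z) - f x) \<le> L * norm z"
          using lipschitz_onD[OF lip m(1) xy(2)] lipschitz_onD[OF lip m(2) xy(1)] by (auto simp: dist_norm)
        moreover have "L * norm z \<le> L * \<rho>" using Kr[OF that] L by (intro mult_left_mono)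
        moreover have "norm ((f (y + z) - f y) - (f (x + z) - f x)) \<le> norm (f (y + z) - f y) + norm (f (x + z) - f x)"
          by (rule norm_triangle_ineq4)
        ultimately have "norm ((f (y + z) - f y) - (f (x + z) - f x)) \<le> 2 * L * \<rho>" by linarith
        then show ?thesis by (simp add: v_def algebra_simps)
      qed
      from has_integral_bound[OF _ i[unfolded K_def] this[unfolded K_def]]
      show ?thesis using L \<rho> by (simp add: K_def)
    qed
    ultimately have "norm (measure lborel K *\<^sub>R (f y - f x)) \<le> e * norm v * measure lborel K + 2 * L * \<rho> * measure lborel K"
      using norm_triangle_ineq4[of "\<Phi> 1 - \<Phi> 0" "(\<Phi> 1 - \<Phi> 0) - measure lborel K *\<^sub>R (f y - f x)"] by simp
    then have "measure lborel K * norm (f y - f x) \<le> measure lborel K * (e * norm v + 2 * L * \<rho>)"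
      using content by (simp only: norm_scaleR) (simp add: distrib_left mult_ac)
    then show ?thesis using content by simp
  qed
  show ?thesis
  proof (rule field_le_epsilon)
    fix \<epsilon> :: real assume \<epsilon>: "\<epsilon> > 0"
    define \<rho> where "\<rho> = min r (\<epsilon> / (2 * L + 1))"
    have "2 * L * \<rho> \<le> (2 * L + 1) * \<rho>" using r \<epsilon> L by (simp add: \<rho>_def)
    also have "\<dots> \<le> (2 * L + 1) * (\<epsilon> / (2 * L + 1))" using L by (intro mult_left_mono) (auto simp: \<rho>_def)
    also have "\<dots> = \<epsilon>" using L by auto
    finally show "norm (f y - f x) \<le> e * norm (y - x) + \<epsilon>"
      using key[of \<rho>] r \<epsilon> L by (auto simp: \<rho>_def v_def)
  qed
qed

lemma AE_lebesgue_on_iff_negligible: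
  assumes "\<Omega> \<in> sets lebesgue"
  shows "(AE x in lebesgue_on \<Omega>. P x) \<longleftrightarrow> (\<exists>N. negligible N \<and> (\<forall>x\<in>\<Omega> - N. P x))"
proof -
  have "(AE x in lebesgue_on \<Omega>. P x) \<longleftrightarrow> (AE x in lebesgue. x \<in> \<Omega> \<longrightarrow> P x)"
    using assms by (intro AE_restrict_space_iff) auto
  also have "\<dots> \<longleftrightarrow> (\<exists>N. negligible N \<and> (\<forall>x\<in>\<Omega> - N. P x))"
    unfolding eventually_ae_filter_negligible by (intro ex_cong1) auto
  finally show ?thesis .
qed

text \<open>
  By the preceding bound, \<open>H - F n\<close> has a small Lipschitz constant on any ball inside \<open>\<Omega>\<close> once \<open>n\<close> is
  large, so at a point where all \<open>F n\<close> are differentiable the usual three-term estimate applies. The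
  index from which the bound is \<open>1 / Suc k\<close> does not depend on the ball, so that one null set,
  determined by countably many conditions, serves all points.
\<close>

lemma AE_has_derivative_of_Linf_limit:
  fixes F :: "nat \<Rightarrow> 'a::euclidean_space \<Rightarrow> 'b::euclidean_space"
  assumes \<Omega>: "open \<Omega>"
    and lip: "\<And>n. \<exists>L. L-lipschitz_on \<Omega> (F n)"
    and der: "\<And>n. AE x in lebesgue_on \<Omega>. (F n has_derivative F' n x) (at x)"
    and G: "\<And>x. bounded_linear (G x)"
    and conv: "\<And>e. e > 0 \<Longrightarrow>
      \<forall>\<^sub>F n in sequentially. AE x in lebesgue_on \<Omega>. onorm (\<lambda>h. F' n x h - G x h) \<le> e"
    and lim: "\<And>x. x \<in> \<Omega> \<Longrightarrow> (\<lambda>n. F n x) \<longlonglongrightarrow> H x"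
  shows "AE x in lebesgue_on \<Omega>. (H has_derivative G x) (at x)"
proof -
  have \<Omega>s: "\<Omega> \<in> sets lebesgue" using \<Omega> by simp
  have "\<exists>n0. \<forall>n\<ge>n0. AE x in lebesgue_on \<Omega>. onorm (\<lambda>h. F' n x h - G x h) \<le> 1 / real (Suc k)" for k
    using conv[of "1 / real (Suc k)"] by (simp add: eventually_sequentially)
  then obtain n0 where n0: "\<And>k n. n \<ge> n0 k \<Longrightarrow>
      AE x in lebesgue_on \<Omega>. onorm (\<lambda>h. F' n x h - G x h) \<le> 1 / real (Suc k)" by metis
  have "AE x in lebesgue_on \<Omega>. \<forall>n. (F n has_derivative F' n x) (at x)"
    using der by (simp add: AE_all_countable)
  moreover have "AE x in lebesgue_on \<Omega>. \<forall>k n. n \<ge> n0 k \<longrightarrow>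
      onorm (\<lambda>h. F' n x h - G x h) \<le> 1 / real (Suc k)"
    using n0 by (simp add: AE_all_countable AE_impI del: of_nat_Suc)
  ultimately have "AE x in lebesgue_on \<Omega>. (\<forall>n. (F n has_derivative F' n x) (at x)) \<and>
     (\<forall>k n. n \<ge> n0 k \<longrightarrow> onorm (\<lambda>h. F' n x h - G x h) \<le> 1 / real (Suc k))"
    by eventually_elim auto
  then obtain N where N: "negligible N"
    and dF: "\<And>x n. x \<in> \<Omega> - N \<Longrightarrow> (F n has_derivative F' n x) (at x)"
    and dG: "\<And>x n k. x \<in> \<Omega> - N \<Longrightarrow> n \<ge> n0 k \<Longrightarrow> onorm (\<lambda>h. F' n x h - G x h) \<le> 1 / real (Suc k)"
    unfolding AE_lebesgue_on_iff_negligible[OF \<Omega>s] by blast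
  have "(H has_derivative G x) (at x)" if x: "x \<in> \<Omega> - N" for x
  proof -
    obtain r where r: "r > 0" "ball x r \<subseteq> \<Omega>"
      using \<Omega> x open_contains_ball by (metis DiffD1)
    have FH: "norm ((H y - H x) - (F n y - F n x)) \<le> 2 / real (Suc k) * norm (y - x)"
      if y: "y \<in> ball x r" and n: "n \<ge> n0 k" for y n k
    proof -
      have "norm ((F m y - F n y) - (F m x - F n x)) \<le> 2 / real (Suc k) * norm (y - x)" if m: "m \<ge> n0 k" for m
      proof -
        obtain La Lb where l: "La-lipschitz_on \<Omega> (F m)" "Lb-lipschitz_on \<Omega> (F n)" using lip by metis
        show ?thesis
        proof (rule norm_diff_le_of_AE_onorm_derivative_le[where U="ball x r" and N=N])
          show "(La + Lb)-lipschitz_on (ball x r) (\<lambda>p. F m p - F n p)"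
            by (intro lipschitz_on_diff lipschitz_on_subset[OF l(1) r(2)] lipschitz_on_subset[OF l(2) r(2)])
          fix p assume "p \<in> ball x r - N"
          then have p: "p \<in> \<Omega> - N" using r by auto
          show "((\<lambda>p. F m p - F n p) has_derivative (\<lambda>h. F' m p h - F' n p h)) (at p)"
            by (intro has_derivative_diff dF p)
          have bl: "bounded_linear (\<lambda>h. F' m p h - G p h)" "bounded_linear (\<lambda>h. G p h - F' n p h)"
            "bounded_linear (\<lambda>h. F' n p h - G p h)"
            by (intro bounded_linear_sub G has_derivative_bounded_linear[OF dF[OF p]])+
          have "onorm (\<lambda>h. (F' m p h - G p h) + (G p h - F' n p h)) \<le>
            onorm (\<lambda>h. F' m p h - G p h) + onorm (\<lambda>h. G p h - F' n p h)"
            by (rule onorm_triangle[OF bl(1,2)])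
          moreover have "onorm (\<lambda>h. G p h - F' n p h) = onorm (\<lambda>h. F' n p h - G p h)"
            using onorm_neg[of "\<lambda>h. F' n p h - G p h"] by simp
          ultimately show "onorm (\<lambda>h. F' m p h - F' n p h) \<le> 2 / real (Suc k)"
            using dG[OF p m] dG[OF p n] by simp
        qed (use N y r in auto)
      qed
      then have ev: "\<forall>\<^sub>F m in sequentially. norm ((F m y - F n y) - (F m x - F n x)) \<le> 2 / real (Suc k) * norm (y - x)"
        unfolding eventually_sequentially by blast
      have "(\<lambda>m. norm ((F m y - F n y) - (F m x - F n x))) \<longlonglongrightarrow> norm ((H y - F n y) - (H x - F n x))"
        using y r x by (intro tendsto_intros lim) auto
      from tendsto_upperbound[OF this ev] show ?thesis by (simp add: algebra_simps)
    qed
    show ?thesis unfolding has_derivative_at_alt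
    proof (intro conjI G allI impI)
      fix e :: real assume e: "e > 0"
      obtain k where k: "1 / real (Suc k) < e / 4" using reals_Archimedean[of "e/4"] e by (auto simp: inverse_eq_divide)
      have q: "2 / real (Suc k) + e / 4 + 1 / real (Suc k) \<le> e"
      proof -
        have "2 / real (Suc k) = 2 * (1 / real (Suc k))" by simp
        with k show ?thesis by linarith
      qed
      define n where "n = n0 k"
      obtain d where d: "d > 0" "\<And>y. norm (y - x) < d \<Longrightarrow> norm (F n y - F n x - F' n x (y - x)) \<le> e / 4 * norm (y - x)"
        using dF[OF x, of n] e unfolding has_derivative_at_alt by (metis divide_pos_pos zero_less_numeral)
      have "norm (H y - H x - G x (y - x)) \<le> e * norm (y - x)" if y: "norm (y - x) < min d r" for y
      proof -
        have 1: "norm ((H y - H x) - (F n y - F n x)) \<le> 2 / real (Suc k) * norm (y - x)"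
          using y by (intro FH) (auto simp: n_def dist_norm norm_minus_commute)
        have 2: "norm (F n y - F n x - F' n x (y - x)) \<le> e / 4 * norm (y - x)" using y d by auto
        have "norm (F' n x (y - x) - G x (y - x)) \<le> onorm (\<lambda>h. F' n x h - G x h) * norm (y - x)"
          by (rule onorm) (intro bounded_linear_sub G has_derivative_bounded_linear[OF dF[OF x]])
        also have "\<dots> \<le> 1 / real (Suc k) * norm (y - x)"
          using dG[OF x, of k n] by (intro mult_right_mono) (auto simp: n_def)
        finally have 3: "norm (F' n x (y - x) - G x (y - x)) \<le> 1 / real (Suc k) * norm (y - x)" .
        have "H y - H x - G x (y - x) = ((H y - H x) - (F n y - F n x)) + (F n y - F n x - F' n x (y - x))
            + (F' n x (y - x) - G x (y - x))" by simp
        then have "norm (H y - H x - G x (y - x)) = norm (((H y - H x) - (F n y - F n x)) + (F n y - F n x - F' n x (y - x))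
            + (F' n x (y - x) - G x (y - x)))" by (rule arg_cong)
        also have "\<dots> \<le> norm ((H y - H x) - (F n y - F n x))
            + norm (F n y - F n x - F' n x (y - x)) + norm (F' n x (y - x) - G x (y - x))"
          by (rule order_trans[OF norm_triangle_ineq add_right_mono[OF norm_triangle_ineq]])
        also have "\<dots> \<le> (2 / real (Suc k) + e / 4 + 1 / real (Suc k)) * norm (y - x)"
          using 1 2 3 by (simp add: distrib_right)
        also have "\<dots> \<le> e * norm (y - x)" using k by (intro mult_right_mono[OF q] norm_ge_zero)
        finally show ?thesis .
      qed
      then show "\<exists>d>0. \<forall>y. norm (y - x) < d \<longrightarrow> norm (H y - H x - G x (y - x)) \<le> e * norm (y - x)"
        using d r by (intro exI[of _ "min d r"]) auto
    qed
  qed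
  then show ?thesis using N \<Omega>s by (auto simp: AE_lebesgue_on_iff_negligible)
qed

section \<open>Taylor estimates in the parameter, off a single null set\<close>

text \<open>
  Differentiability at every point is what makes an almost everywhere bound on \<open>g'\<close> sufficient: the
  Henstock-Kurzweil integral recovers \<open>g\<close> from \<open>g'\<close> and ignores null sets.
\<close>

lemma norm_increment_le_of_AE_derivative:
  fixes g :: "real \<Rightarrow> 'b::banach"
  assumes "a \<le> b" and der: "\<And>s. s \<in> {a..b} \<Longrightarrow> (g has_vector_derivative g' s) (at s)"
    and N: "negligible N" and bnd: "\<And>s. s \<in> {a..b} - N \<Longrightarrow> norm (g' s) \<le> B" and B: "0 \<le> B"
  shows "norm (g b - g a) \<le> B * (b - a)"
proof -
  have "(g' has_integral (g b - g a)) {a..b}"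
    by (rule fundamental_theorem_of_calculus[OF assms(1) has_vector_derivative_at_within[OF der]])
  then have "((\<lambda>s. if s \<in> N then 0 else g' s) has_integral (g b - g a)) {a..b}"
    by (rule has_integral_spike[OF N, rotated]) auto
  from has_integral_bound_real[OF B finite.emptyI this] show ?thesis
    using assms(1) bnd B by auto
qed

text \<open>
  Caratheodory functions are jointly measurable: rounding \<open>s\<close> down to multiples of \<open>1 / Suc n\<close> gives
  approximations that depend on \<open>s\<close> only through an integer.
\<close>

lemma borel_measurable_caratheodory:
  fixes g :: "real \<Rightarrow> 'a \<Rightarrow> 'b::metric_space"
  assumes meas: "\<And>s. g s \<in> borel_measurable M"
    and cont: "\<And>x. x \<in> space M \<Longrightarrow> continuous_on UNIV (\<lambda>s. g s x)"
  shows "(\<lambda>p. g (fst p) (snd p)) \<in> borel_measurable (borel \<Otimes>\<^sub>M M)"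
proof (rule borel_measurable_LIMSEQ_metric)
  fix n
  show "(\<lambda>p. g (real_of_int \<lfloor>fst p * real (Suc n)\<rfloor> / real (Suc n)) (snd p)) \<in> borel_measurable (borel \<Otimes>\<^sub>M M)"
  proof (rule measurable_compose_countable[where g="\<lambda>p. \<lfloor>fst p * real (Suc n)\<rfloor>" and
        f="\<lambda>i p. g (real_of_int i / real (Suc n)) (snd p)"])
    show "(\<lambda>p. g (real_of_int i / real (Suc n)) (snd p)) \<in> borel_measurable (borel \<Otimes>\<^sub>M M)" for i
      by (rule measurable_compose[OF measurable_snd meas])
    show "(\<lambda>p. \<lfloor>fst p * real (Suc n)\<rfloor>) \<in> measurable (borel \<Otimes>\<^sub>M M) (count_space UNIV)"
      by measurable
  qed
next
  fix p :: "real \<times> 'a" assume p: "p \<in> space (borel \<Otimes>\<^sub>M M)"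
  then have x: "snd p \<in> space M" by (auto simp: space_pair_measure)
  have "(\<lambda>n. real_of_int \<lfloor>fst p * real (Suc n)\<rfloor> / real (Suc n)) \<longlonglongrightarrow> fst p"
  proof (rule tendsto_sandwich)
    show "\<forall>\<^sub>F n in sequentially. fst p - 1 / real (Suc n) \<le> real_of_int \<lfloor>fst p * real (Suc n)\<rfloor> / real (Suc n)"
    proof (rule always_eventually, rule allI)
      fix n
      have "fst p * real (Suc n) - 1 \<le> real_of_int \<lfloor>fst p * real (Suc n)\<rfloor>" by (rule less_imp_le[OF real_of_int_floor_gt_diff_one])
      then have "(fst p * real (Suc n) - 1) / real (Suc n) \<le> real_of_int \<lfloor>fst p * real (Suc n)\<rfloor> / real (Suc n)"
        by (intro divide_right_mono) auto
      then show "fst p - 1 / real (Suc n) \<le> real_of_int \<lfloor>fst p * real (Suc n)\<rfloor> / real (Suc n)"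
        by (simp add: diff_divide_distrib del: of_nat_Suc)
    qed
    show "\<forall>\<^sub>F n in sequentially. real_of_int \<lfloor>fst p * real (Suc n)\<rfloor> / real (Suc n) \<le> fst p"
    proof (rule always_eventually, rule allI)
      fix n
      have "real_of_int \<lfloor>fst p * real (Suc n)\<rfloor> / real (Suc n) \<le> fst p * real (Suc n) / real (Suc n)"
        by (intro divide_right_mono) auto
      then show "real_of_int \<lfloor>fst p * real (Suc n)\<rfloor> / real (Suc n) \<le> fst p"
        by (simp del: of_nat_Suc)
    qed
    show "(\<lambda>n. fst p - 1 / real (Suc n)) \<longlonglongrightarrow> fst p"
      using tendsto_diff[OF tendsto_const LIMSEQ_inverse_real_of_nat, of "fst p"]
      by (simp add: inverse_eq_divide)
  qed auto
  then show "(\<lambda>n. g (real_of_int \<lfloor>fst p * real (Suc n)\<rfloor> / real (Suc n)) (snd p)) \<longlonglongrightarrow> g (fst p) (snd p)"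
    by (rule continuous_on_tendsto_compose[OF cont[OF x]]) auto
qed

text \<open>
  The hypothesis \<open>near\<close> provides a null set for each \<open>s\<close>. The derivative in \<open>s\<close> is a limit of
  difference quotients of a Caratheodory function, hence jointly measurable, and Fubini's theorem gives,
  for almost every \<open>x\<close>, the bound at almost every \<open>s\<close>. Integrating in \<open>s\<close> then treats
  all \<open>t\<close> simultaneously.
\<close>

lemma AE_increment_le_of_Linf_derivative:
  fixes G :: "real \<Rightarrow> 'a::euclidean_space \<Rightarrow> 'b::euclidean_space"
  assumes \<Omega>: "\<Omega> \<in> lmeasurable" and \<epsilon>: "\<epsilon> > 0"
    and meas: "\<And>s. s \<in> {-\<epsilon><..<\<epsilon>} \<Longrightarrow> G s \<in> borel_measurable (lebesgue_on \<Omega>)"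
    and c: "c \<in> borel_measurable (lebesgue_on \<Omega>)"
    and diff: "AE x in lebesgue_on \<Omega>. \<forall>s\<in>{-\<epsilon><..<\<epsilon>}. (\<lambda>r. G r x) differentiable (at s)"
    and near: "\<And>s. s \<in> {-\<epsilon><..<\<epsilon>} \<Longrightarrow> AE x in lebesgue_on \<Omega>. norm (partial_t G s x - c x) \<le> \<eta>"
    and \<eta>: "0 \<le> \<eta>"
  shows "AE x in lebesgue_on \<Omega>. \<forall>t\<in>{-\<epsilon><..<\<epsilon>}. norm (G t x - G 0 x - t *\<^sub>R c x) \<le> \<eta> * \<bar>t\<bar>"
proof -
  have \<Omega>s: "\<Omega> \<in> sets lebesgue" using \<Omega> by (rule fmeasurableD)
  obtain N where N: "negligible N"
    and der: "\<And>x s. x \<in> \<Omega> - N \<Longrightarrow> s \<in> {-\<epsilon><..<\<epsilon>} \<Longrightarrow> ((\<lambda>r. G r x) has_vector_derivative partial_t G s x) (at s)"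
    using diff unfolding AE_lebesgue_on_iff_negligible[OF \<Omega>s] partial_t_def
    by (metis vector_derivative_works)
  have notN: "AE x in lebesgue_on \<Omega>. x \<notin> N"
    unfolding AE_lebesgue_on_iff_negligible[OF \<Omega>s] using N by blast
  interpret X: finite_measure "lebesgue_on \<Omega>" by (rule finite_measure_lebesgue_on[OF \<Omega>])
  interpret P: pair_sigma_finite "lborel :: real measure" "lebesgue_on \<Omega>" ..
  have Nmeas: "N \<inter> \<Omega> \<in> sets (lebesgue_on \<Omega>)"
    using N \<Omega>s by (auto simp: sets_restrict_space negligible_imp_sets)
  have small: "AE x in lebesgue_on \<Omega>. AE s in lborel. \<bar>s\<bar> < \<delta> \<longrightarrow> norm (partial_t G s x - c x) \<le> \<eta>"
    if \<delta>: "0 < \<delta>" "\<delta> < \<epsilon>" for \<delta>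
  proof -
    \<comment> \<open>Clamping \<open>s\<close> to \<open>[-\<delta>, \<delta>]\<close> and cutting off the null set make \<open>h\<close> continuous in \<open>s\<close> on all of \<open>\<real>\<close> without exception.\<close>
    define clip where "clip s = max (- \<delta>) (min \<delta> s)" for s
    have clip: "clip s \<in> {-\<epsilon><..<\<epsilon>}" for s using \<delta> by (auto simp: clip_def)
    define h where "h s x = (if x \<in> N \<inter> \<Omega> then 0 else G (clip s) x)" for s x
    have h_meas: "h s \<in> borel_measurable (lebesgue_on \<Omega>)" for s
      unfolding h_def by (rule measurable_If_set) (use meas[OF clip] Nmeas in \<open>auto simp: sets_restrict_space\<close>)
    have h_cont: "continuous_on UNIV (\<lambda>s. h s x)" if "x \<in> space (lebesgue_on \<Omega>)" for x
    proof (cases "x \<in> N")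
      case True then show ?thesis using that by (simp add: h_def)
    next
      case False
      then have "continuous_on {-\<epsilon><..<\<epsilon>} (\<lambda>s. G s x)"
        using der that by (intro continuous_at_imp_continuous_on ballI has_vector_derivative_continuous) auto
      then have "continuous_on UNIV (\<lambda>s. G (clip s) x)"
        by (rule continuous_on_compose2) (use clip in \<open>auto simp: clip_def intro!: continuous_intros\<close>)
      then show ?thesis using False by (simp add: h_def)
    qed
    define D where "D s x = lim (\<lambda>n. (1 / (s + 1 / real (Suc n) - s)) *\<^sub>R (h (s + 1 / real (Suc n)) x - h s x))" for s x
    have h_joint: "(\<lambda>p. h (fst p + r) (snd p)) \<in> borel_measurable (borel \<Otimes>\<^sub>M lebesgue_on \<Omega>)" for r
    proof (rule borel_measurable_caratheodory[where g="\<lambda>s. h (s + r)"])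
      show "continuous_on UNIV (\<lambda>s. h (s + r) x)" if "x \<in> space (lebesgue_on \<Omega>)" for x
        by (rule continuous_on_compose2[OF h_cont[OF that]]) (auto intro!: continuous_intros)
    qed (rule h_meas)
    have D_joint: "(\<lambda>p. D (fst p) (snd p)) \<in> borel_measurable (borel \<Otimes>\<^sub>M lebesgue_on \<Omega>)"
      unfolding D_def
    proof (intro borel_measurable_lim_metric borel_measurable_scaleR borel_measurable_diff h_joint)
      show "(\<lambda>p. h (fst p) (snd p)) \<in> borel_measurable (borel \<Otimes>\<^sub>M lebesgue_on \<Omega>)"
        using h_joint[of 0] by simp
    qed measurable
    have D_eq: "D s x = partial_t G s x" if s: "\<bar>s\<bar> < \<delta>" and x: "x \<in> \<Omega> - N" for s x
    proof -
      have "((\<lambda>r. G r x) has_vector_derivative partial_t G s x) (at s)"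
        using s \<delta> by (intro der x) auto
      then have "((\<lambda>r. h r x) has_vector_derivative partial_t G s x) (at s)"
      proof (rule has_vector_derivative_transform_within_open)
        show "open {-\<delta><..<\<delta>}" "s \<in> {-\<delta><..<\<delta>}" using s by auto
        show "G r x = h r x" if "r \<in> {-\<delta><..<\<delta>}" for r
          using that x by (auto simp: h_def clip_def)
      qed
      then have "((\<lambda>r. (1 / (r - s)) *\<^sub>R (h r x - h s x)) \<longlongrightarrow> partial_t G s x) (at s)"
        by (simp add: has_vector_derivative_within_iff_slope)
      moreover have "filterlim (\<lambda>n. s + 1 / real (Suc n)) (at s) sequentially"
        unfolding filterlim_at
        using tendsto_add[OF tendsto_const LIMSEQ_inverse_real_of_nat, of s]
        by (auto simp: inverse_eq_divide)
      ultimately have "(\<lambda>n. (1 / (s + 1 / real (Suc n) - s)) *\<^sub>R (h (s + 1 / real (Suc n)) x - h s x)) \<longlonglongrightarrow> partial_t G s x"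
        by (rule filterlim_compose)
      then show ?thesis unfolding D_def by (rule limI)
    qed
    have "AE s in lborel. AE x in lebesgue_on \<Omega>. \<bar>s\<bar> < \<delta> \<longrightarrow> norm (D s x - c x) \<le> \<eta>"
    proof (rule AE_I2)
      fix s
      show "AE x in lebesgue_on \<Omega>. \<bar>s\<bar> < \<delta> \<longrightarrow> norm (D s x - c x) \<le> \<eta>"
      proof (cases "\<bar>s\<bar> < \<delta>")
        case True
        then have "AE x in lebesgue_on \<Omega>. norm (partial_t G s x - c x) \<le> \<eta>"
          using \<delta> by (intro near) auto
        with notN AE_space show ?thesis by eventually_elim (use D_eq in auto)
      qed simp
    qed
    moreover have "{p \<in> space (lborel \<Otimes>\<^sub>M lebesgue_on \<Omega>). \<bar>fst p\<bar> < \<delta> \<longrightarrow> norm (D (fst p) (snd p) - c (snd p)) \<le> \<eta>}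
        \<in> sets (lborel \<Otimes>\<^sub>M lebesgue_on \<Omega>)"
    proof -
      have [measurable]: "(\<lambda>p. D (fst p) (snd p)) \<in> borel_measurable (lborel \<Otimes>\<^sub>M lebesgue_on \<Omega>)"
        using D_joint by (simp cong: measurable_cong_sets add: sets_pair_measure_cong[OF sets_lborel refl])
      note c[measurable]
      show ?thesis by measurable
    qed
    ultimately have "AE x in lebesgue_on \<Omega>. AE s in lborel. \<bar>s\<bar> < \<delta> \<longrightarrow> norm (D s x - c x) \<le> \<eta>"
      using P.AE_commute[of "\<lambda>s x. \<bar>s\<bar> < \<delta> \<longrightarrow> norm (D s x - c x) \<le> \<eta>"] by simp
    with notN AE_space show ?thesis
      by eventually_elim (auto elim!: eventually_mono simp: D_eq)
  qed
  \<comment> \<open>The radii \<open>\<epsilon> (1 - 1 / (n + 2))\<close> exhaust the open interval by countably many subintervals to which \<open>small\<close> applies.\<close>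
  have "AE x in lebesgue_on \<Omega>. \<forall>n. AE s in lborel. \<bar>s\<bar> < \<epsilon> * (1 - 1 / real (n + 2)) \<longrightarrow> norm (partial_t G s x - c x) \<le> \<eta>"
    unfolding AE_all_countable
  proof
    fix n
    have "\<epsilon> * (1 - 1 / real (n + 2)) < \<epsilon> * 1" using \<epsilon> by (intro mult_strict_left_mono) auto
    moreover have "0 < \<epsilon> * (1 - 1 / real (n + 2))" using \<epsilon> by simp
    ultimately show "AE x in lebesgue_on \<Omega>. AE s in lborel. \<bar>s\<bar> < \<epsilon> * (1 - 1 / real (n + 2)) \<longrightarrow> norm (partial_t G s x - c x) \<le> \<eta>"
      by (intro small) auto
  qed
  with notN AE_space show ?thesis
  proof eventually_elim
    case (elim x)
    then have x: "x \<in> \<Omega> - N" by simp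
    show ?case
    proof
      fix t assume t: "t \<in> {-\<epsilon><..<\<epsilon>}"
      have "\<bar>t\<bar> / \<epsilon> < 1" using t \<epsilon> by auto
      then obtain n where n: "1 / real (Suc n) < 1 - \<bar>t\<bar> / \<epsilon>"
        using reals_Archimedean[of "1 - \<bar>t\<bar> / \<epsilon>"] by (auto simp: inverse_eq_divide)
      have "1 / real (n + 2) \<le> 1 / real (Suc n)" by (simp add: frac_le)
      with n have "\<bar>t\<bar> / \<epsilon> < 1 - 1 / real (n + 2)" by linarith
      then have tn: "\<bar>t\<bar> < \<epsilon> * (1 - 1 / real (n + 2))" using \<epsilon> by (simp add: pos_divide_less_eq mult.commute)
      have "AE s in lebesgue. \<bar>s\<bar> < \<epsilon> * (1 - 1 / real (n + 2)) \<longrightarrow> norm (partial_t G s x - c x) \<le> \<eta>"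
        using elim by (intro AE_completion) auto
      then obtain N' where N': "negligible N'"
        "\<And>s. s \<notin> N' \<Longrightarrow> \<bar>s\<bar> < \<epsilon> * (1 - 1 / real (n + 2)) \<Longrightarrow> norm (partial_t G s x - c x) \<le> \<eta>"
        unfolding eventually_ae_filter_negligible by blast
      have d: "((\<lambda>s. G s x - s *\<^sub>R c x) has_vector_derivative (partial_t G s x - c x)) (at s)" if "s \<in> {-\<epsilon><..<\<epsilon>}" for s
        using der[OF x that] by (auto intro!: derivative_eq_intros)
      have inc: "norm ((G b x - b *\<^sub>R c x) - (G a x - a *\<^sub>R c x)) \<le> \<eta> * (b - a)"
        if ab: "a \<le> b" "- \<bar>t\<bar> \<le> a" "b \<le> \<bar>t\<bar>" for a b
      proof (rule norm_increment_le_of_AE_derivative[OF ab(1) d N'(1) N'(2) \<eta>])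
        show "s \<in> {-\<epsilon><..<\<epsilon>}" if "s \<in> {a..b}" for s using that ab t by auto
        show "\<bar>s\<bar> < \<epsilon> * (1 - 1 / real (n + 2))" if "s \<in> {a..b} - N'" for s using that ab tn by auto
      qed auto
      show "norm (G t x - G 0 x - t *\<^sub>R c x) \<le> \<eta> * \<bar>t\<bar>"
      proof (cases "t \<ge> 0")
        case True
        with inc[of 0 t] show ?thesis by (simp add: algebra_simps)
      next
        case False
        have "norm (G t x - G 0 x - t *\<^sub>R c x) = norm ((G 0 x - 0 *\<^sub>R c x) - (G t x - t *\<^sub>R c x))"
          by (subst norm_minus_commute) (simp add: algebra_simps)
        with inc[of t 0] False show ?thesis by simp
      qed
    qed
  qed
qed

lemma C2_Linf_first_order:
  fixes F :: "real \<Rightarrow> real^'n \<Rightarrow> 'b::euclidean_space"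
  assumes F: "C2_Linf \<epsilon> \<Omega> F" and \<epsilon>: "\<epsilon> > 0" and \<Omega>: "\<Omega> \<in> lmeasurable" and l: "l < 2" and \<eta>: "\<eta> > 0"
  obtains \<delta> where "0 < \<delta>" "\<delta> \<le> \<epsilon>"
    "AE x in lebesgue_on \<Omega>. \<forall>t\<in>{-\<delta><..<\<delta>}.
       norm ((partial_t ^^ l) F t x - (partial_t ^^ l) F 0 x - t *\<^sub>R (partial_t ^^ Suc l) F 0 x) \<le> \<eta> * \<bar>t\<bar>"
proof -
  let ?G = "(partial_t ^^ l) F" and ?c = "(partial_t ^^ Suc l) F 0"
  have meas: "(partial_t ^^ j) F t \<in> borel_measurable (lebesgue_on \<Omega>)" if "j \<le> 2" "t \<in> {-\<epsilon><..<\<epsilon>}" for j t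
    using F that unfolding C2_Linf_def by blast
  have diff: "AE x in lebesgue_on \<Omega>. \<forall>t\<in>{-\<epsilon><..<\<epsilon>}. (\<lambda>s. ?G s x) differentiable (at t)"
    using F l unfolding C2_Linf_def by blast
  have "((\<lambda>s. Linf_norm \<Omega> (\<lambda>x. (partial_t ^^ Suc l) F s x - ?c x)) \<longlongrightarrow> 0) (at 0)"
    using F l \<epsilon> unfolding C2_Linf_def by (simp del: funpow.simps)
  then have "\<forall>\<^sub>F s in at 0. Linf_norm \<Omega> (\<lambda>x. (partial_t ^^ Suc l) F s x - ?c x) < ereal \<eta>"
    using \<eta> by (intro order_tendstoD(2)) auto
  then obtain d where d: "d > 0"
    "\<And>s. s \<noteq> 0 \<Longrightarrow> \<bar>s\<bar> < d \<Longrightarrow> Linf_norm \<Omega> (\<lambda>x. (partial_t ^^ Suc l) F s x - ?c x) < ereal \<eta>"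
    unfolding eventually_at by (auto simp: dist_real_def)
  define \<delta> where "\<delta> = min d \<epsilon>"
  have near: "AE x in lebesgue_on \<Omega>. norm (partial_t ?G s x - ?c x) \<le> \<eta>" if s: "s \<in> {-\<delta><..<\<delta>}" for s
  proof (cases "s = 0")
    case True then show ?thesis using \<eta> by simp
  next
    case False
    have less: "Linf_norm \<Omega> (\<lambda>x. (partial_t ^^ Suc l) F s x - ?c x) < ereal \<eta>"
      using s False by (intro d(2)) (auto simp: \<delta>_def)
    have "AE x in lebesgue_on \<Omega>. ereal (norm ((partial_t ^^ Suc l) F s x - ?c x))
        \<le> Linf_norm \<Omega> (\<lambda>x. (partial_t ^^ Suc l) F s x - ?c x)"
      unfolding Linf_norm_def by (rule esssup_AE)
    then show ?thesis
    proof eventually_elim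
      case (elim x)
      from le_less_trans[OF elim less] show ?case by simp
    qed
  qed
  have \<delta>: "0 < \<delta>" "\<delta> \<le> \<epsilon>" using d \<epsilon> by (auto simp: \<delta>_def)
  have "AE x in lebesgue_on \<Omega>. \<forall>t\<in>{-\<delta><..<\<delta>}. norm (?G t x - ?G 0 x - t *\<^sub>R ?c x) \<le> \<eta> * \<bar>t\<bar>"
  proof (rule AE_increment_le_of_Linf_derivative[OF \<Omega> \<delta>(1) _ _ _ near])
    show "?G s \<in> borel_measurable (lebesgue_on \<Omega>)" if "s \<in> {-\<delta><..<\<delta>}" for s
      using that l \<delta> by (intro meas) auto
    show "?c \<in> borel_measurable (lebesgue_on \<Omega>)" using l \<epsilon> by (intro meas) auto
    show "AE x in lebesgue_on \<Omega>. \<forall>s\<in>{-\<delta><..<\<delta>}. (\<lambda>r. ?G r x) differentiable (at s)"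
      using diff by eventually_elim (use \<delta> in auto)
  qed (use \<eta> in auto)
  with \<delta> show ?thesis by (rule that)
qed

text \<open>
  The first-order estimate for \<open>\<partial>\<^sub>t F\<close> bounds the derivative of the second-order Taylor remainder of
  \<open>F\<close>; it already holds for all \<open>t\<close> off one null set, so the remainder is estimated pointwise in \<open>x\<close>.
\<close>

lemma C2_Linf_second_order:
  fixes F :: "real \<Rightarrow> real^'n \<Rightarrow> 'b::euclidean_space"
  assumes F: "C2_Linf \<epsilon> \<Omega> F" and \<epsilon>: "\<epsilon> > 0" and \<Omega>: "\<Omega> \<in> lmeasurable" and \<eta>: "\<eta> > 0"
  obtains \<delta> where "0 < \<delta>" "\<delta> \<le> \<epsilon>"
    "AE x in lebesgue_on \<Omega>. \<forall>t\<in>{-\<delta><..<\<delta>}.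
       norm (F t x - F 0 x - t *\<^sub>R partial_t F 0 x - (t\<^sup>2 / 2) *\<^sub>R (partial_t ^^ 2) F 0 x) \<le> \<eta> * t\<^sup>2"
proof -
  obtain \<delta> where \<delta>: "0 < \<delta>" "\<delta> \<le> \<epsilon>" and 1: "AE x in lebesgue_on \<Omega>. \<forall>t\<in>{-\<delta><..<\<delta>}.
       norm (partial_t F t x - partial_t F 0 x - t *\<^sub>R (partial_t ^^ 2) F 0 x) \<le> \<eta> * \<bar>t\<bar>"
    using C2_Linf_first_order[OF F \<epsilon> \<Omega>, of 1 \<eta>] \<eta> by (auto simp: numeral_2_eq_2)
  have "\<forall>l<2. AE x in lebesgue_on \<Omega>. \<forall>t\<in>{-\<epsilon><..<\<epsilon>}. (\<lambda>s. (partial_t ^^ l) F s x) differentiable (at t)"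
    using F unfolding C2_Linf_def by blast
  from this[rule_format, of 0] have 2: "AE x in lebesgue_on \<Omega>. \<forall>t\<in>{-\<epsilon><..<\<epsilon>}. (\<lambda>s. F s x) differentiable (at t)"
    by simp
  from 1 2 have "AE x in lebesgue_on \<Omega>. \<forall>t\<in>{-\<delta><..<\<delta>}.
       norm (F t x - F 0 x - t *\<^sub>R partial_t F 0 x - (t\<^sup>2 / 2) *\<^sub>R (partial_t ^^ 2) F 0 x) \<le> \<eta> * t\<^sup>2"
  proof eventually_elim
    case (elim x)
    define p where "p = partial_t F 0 x"
    define q where "q = (partial_t ^^ 2) F 0 x"
    define g where "g s = F s x - s *\<^sub>R p - (s\<^sup>2 / 2) *\<^sub>R q" for s
    have dg: "(g has_vector_derivative (partial_t F s x - p - s *\<^sub>R q)) (at s)" if "s \<in> {-\<delta><..<\<delta>}" for s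
    proof -
      have "((\<lambda>s. F s x) has_vector_derivative partial_t F s x) (at s)"
        using elim(2) that \<delta> unfolding partial_t_def by (auto simp: vector_derivative_works[symmetric])
      then show ?thesis unfolding g_def[abs_def]
        by (auto intro!: derivative_eq_intros simp: power2_eq_square)
    qed
    have inc: "norm (g b - g a) \<le> \<eta> * \<bar>t\<bar> * (b - a)"
      if t: "t \<in> {-\<delta><..<\<delta>}" and ab: "a \<le> b" "- \<bar>t\<bar> \<le> a" "b \<le> \<bar>t\<bar>" for a b t
    proof (rule norm_increment_le_of_AE_derivative[OF ab(1) dg negligible_empty])
      fix s assume "s \<in> {a..b} - {}"
      then have s: "s \<in> {-\<delta><..<\<delta>}" "\<bar>s\<bar> \<le> \<bar>t\<bar>" using t ab by auto
      have "norm (partial_t F s x - p - s *\<^sub>R q) \<le> \<eta> * \<bar>s\<bar>"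
        using elim(1) s(1) unfolding p_def q_def by blast
      also have "\<dots> \<le> \<eta> * \<bar>t\<bar>" using \<eta> s by (intro mult_left_mono) auto
      finally show "norm (partial_t F s x - p - s *\<^sub>R q) \<le> \<eta> * \<bar>t\<bar>" .
    qed (use t ab \<eta> in auto)
    show ?case unfolding p_def[symmetric] q_def[symmetric]
    proof
      fix t assume t: "t \<in> {-\<delta><..<\<delta>}"
      have "norm (g t - g 0) \<le> \<eta> * \<bar>t\<bar> * \<bar>t\<bar>"
      proof (cases "t \<ge> 0")
        case True then show ?thesis using inc[OF t, of 0 t] by simp
      next
        case False then show ?thesis using inc[OF t, of t 0] by (simp add: norm_minus_commute)
      qed
      moreover have "g t - g 0 = F t x - F 0 x - t *\<^sub>R p - (t\<^sup>2 / 2) *\<^sub>R q" by (simp add: g_def)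
      ultimately show "norm (F t x - F 0 x - t *\<^sub>R p - (t\<^sup>2 / 2) *\<^sub>R q) \<le> \<eta> * t\<^sup>2"
        by (simp add: power2_eq_square abs_mult_self_eq mult.assoc)
    qed
  qed
  with \<delta> show ?thesis by (rule that)
qed

section \<open>The Jacobi matrices of S and R\<close>

lemma norm_matrix_vector_mult_le: "norm (A *v x) \<le> norm A * norm x"
  for A :: "real^'n^'m"
proof -
  have "norm (A *v x) = L2_set (\<lambda>i. norm (A $ i \<bullet> x)) UNIV"
    by (simp add: norm_vec_def matrix_vector_mul_component)
  also have "\<dots> \<le> L2_set (\<lambda>i. norm (A $ i) * norm x) UNIV"
    by (intro L2_set_mono) (auto simp: Cauchy_Schwarz_ineq2)
  also have "\<dots> = norm A * norm x"
    by (simp add: norm_vec_def L2_set_left_distrib)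
  finally show ?thesis .
qed

lemma Jac_eqI: "(F has_derivative (*v) A) (at x) \<Longrightarrow> Jac F x = A"
  unfolding jacobian_def by (metis frechet_derivative_at matrix_of_matrix_vector_mul)

lemma AE_has_derivative_of_Linf_limit_matrix:
  fixes F :: "nat \<Rightarrow> real^'n \<Rightarrow> real^'m"
  assumes \<Omega>: "open \<Omega>"
    and lip: "\<And>n. \<exists>L. L-lipschitz_on \<Omega> (F n)"
    and der: "\<And>n. AE x in lebesgue_on \<Omega>. (F n has_derivative (*v) (A n x)) (at x)"
    and conv: "\<And>e. e > 0 \<Longrightarrow> \<forall>\<^sub>F n in sequentially. AE x in lebesgue_on \<Omega>. norm (A n x - B x) \<le> e"
    and lim: "\<And>x. x \<in> \<Omega> \<Longrightarrow> (\<lambda>n. F n x) \<longlonglongrightarrow> H x"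
  shows "AE x in lebesgue_on \<Omega>. (H has_derivative (*v) (B x)) (at x)"
proof (rule AE_has_derivative_of_Linf_limit[OF \<Omega> lip der _ _ lim])
  fix e :: real assume "e > 0"
  from conv[OF this] show "\<forall>\<^sub>F n in sequentially. AE x in lebesgue_on \<Omega>.
      onorm (\<lambda>h. A n x *v h - B x *v h) \<le> e"
  proof eventually_elim
    case (elim n)
    then show ?case
    proof eventually_elim
      case (elim x)
      have "onorm (\<lambda>h. A n x *v h - B x *v h) \<le> norm (A n x - B x)"
        by (rule onorm_bound)
          (simp_all add: matrix_vector_mult_diff_rdistrib[symmetric] norm_matrix_vector_mult_le)
      with elim show ?case by simp
    qed
  qed
qed simp

text \<open>
  Along a sequence \<open>\<tau> n\<close> tending to \<open>0\<close>, the maps \<open>(T t - I) / t\<close> converge to \<open>S\<close> and their Jacobi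
  matrices converge in \<open>L\<^sup>\<infinity>\<close> to \<open>\<partial>\<^sub>t DT\<close> at \<open>0\<close>. Once \<open>S\<close> is known to be differentiable almost everywhere, the same
  argument applies to \<open>2 (T t - I - t S) / t\<^sup>2\<close> and \<open>R\<close>. The punctured limit in the expansion says nothing about \<open>t = 0\<close>; that \<open>T 0\<close>
  is the identity follows from continuity in \<open>t\<close>.
\<close>

lemma AE_Jac_of_second_order_expansion:
  fixes T :: "real \<Rightarrow> real^'n \<Rightarrow> real^'n"
  assumes \<Omega>: "open \<Omega>" "bounded \<Omega>" and \<epsilon>: "\<epsilon> > 0" and T: "C2_family \<epsilon> \<Omega> T"
    and S: "L\<^sub>S-lipschitz_on \<Omega> S"
    and expansion: "uniform_limit \<Omega>
           (\<lambda>t x. (1 / t\<^sup>2) *\<^sub>R (T t x - (x + t *\<^sub>R S x + (t\<^sup>2 / 2) *\<^sub>R R x))) (\<lambda>x. 0) (at 0)"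
  shows "x \<in> \<Omega> \<Longrightarrow> Jac (T 0) x = mat 1"
    and "AE x in lebesgue_on \<Omega>. Jac S x = partial_t (\<lambda>t x. Jac (T t) x) 0 x"
    and "AE x in lebesgue_on \<Omega>. Jac R x = (partial_t ^^ 2) (\<lambda>t x. Jac (T t) x) 0 x"
proof -
  let ?J = "\<lambda>t x. Jac (T t) x"
  have lm: "\<Omega> \<in> lmeasurable" using \<Omega> by (simp add: lmeasurable_open)
  then have \<Omega>s: "\<Omega> \<in> sets lebesgue" by (rule fmeasurableD)
  have J: "C2_Linf \<epsilon> \<Omega> ?J" using T unfolding C2_family_def by blast
  have Tlip: "\<exists>L. L-lipschitz_on \<Omega> (T t)" if "t \<in> {-\<epsilon><..<\<epsilon>}" for t
    using T that unfolding C2_family_def bilipschitz_homeomorphism_def by blast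
  have Tder: "AE x in lebesgue_on \<Omega>. (T t has_derivative (*v) (?J t x)) (at x)" if "t \<in> {-\<epsilon><..<\<epsilon>}" for t
  proof -
    have "AE x in lebesgue_on \<Omega>. \<forall>t\<in>{-\<epsilon><..<\<epsilon>}. T t differentiable (at x)"
      using T unfolding C2_family_def by blast
    then show ?thesis by eventually_elim (use that in \<open>auto simp: jacobian_works[symmetric]\<close>)
  qed
  define E where "E t x = (1 / t\<^sup>2) *\<^sub>R (T t x - (x + t *\<^sub>R S x + (t\<^sup>2 / 2) *\<^sub>R R x))" for t x
  have E: "((\<lambda>t. E t x) \<longlongrightarrow> 0) (at 0)" if "x \<in> \<Omega>" for x
    using tendsto_uniform_limitI[OF expansion that] by (simp add: E_def)
  have TE: "T t x = x + t *\<^sub>R S x + (t\<^sup>2 / 2) *\<^sub>R R x + t\<^sup>2 *\<^sub>R E t x" if "t \<noteq> 0" for t x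
    using that by (simp add: E_def)
  have T0: "T 0 x = x" if x: "x \<in> \<Omega>" for x
  proof -
    have "(\<lambda>s. (partial_t ^^ 0) T s x) differentiable (at 0)"
    proof -
      have "\<forall>l<2. \<forall>x\<in>\<Omega>. \<forall>t\<in>{-\<epsilon><..<\<epsilon>}. (\<lambda>s. (partial_t ^^ l) T s x) differentiable (at t)"
        using T unfolding C2_family_def by blast
      from this[rule_format, of 0 x 0] show ?thesis using x \<epsilon> by simp
    qed
    then have "((\<lambda>t. T t x) \<longlongrightarrow> T 0 x) (at 0)"
      using differentiable_imp_continuous_within[of "\<lambda>s. T s x" 0 UNIV] by (simp add: isCont_def)
    moreover have "((\<lambda>t. T t x) \<longlongrightarrow> x) (at 0)"
    proof (rule Lim_transform_within_open[where s=UNIV])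
      show "((\<lambda>t. x + t *\<^sub>R S x + (t\<^sup>2 / 2) *\<^sub>R R x + t\<^sup>2 *\<^sub>R E t x) \<longlongrightarrow> x) (at 0)"
      proof -
        have "((\<lambda>t. x + t *\<^sub>R S x + (t\<^sup>2 / 2) *\<^sub>R R x + t\<^sup>2 *\<^sub>R E t x)
            \<longlongrightarrow> x + 0 *\<^sub>R S x + (0\<^sup>2 / 2) *\<^sub>R R x + 0\<^sup>2 *\<^sub>R 0) (at 0)"
          by (intro tendsto_intros E[OF x]) auto
        then show ?thesis by simp
      qed
    qed (simp_all add: TE[symmetric])
    ultimately show ?thesis by (rule LIM_unique)
  qed
  show J0: "Jac (T 0) x = mat 1" if x: "x \<in> \<Omega>" for x
  proof (rule Jac_eqI, rule has_derivative_transform_within_open[OF _ \<Omega>(1) x])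
    show "((\<lambda>y. y) has_derivative (*v) (mat 1)) (at x)"
      by (rule has_derivative_eq_rhs[OF has_derivative_ident]) (simp add: fun_eq_iff)
  qed (simp add: T0)
  define \<tau> where "\<tau> n = \<epsilon> / real (n + 2)" for n
  have \<tau>: "\<tau> n > 0" "\<tau> n \<in> {-\<epsilon><..<\<epsilon>}" for n
  proof -
    show "\<tau> n > 0" using \<epsilon> by (simp add: \<tau>_def)
    moreover have "\<tau> n < \<epsilon> / 1" unfolding \<tau>_def using \<epsilon> by (intro divide_strict_left_mono) auto
    ultimately show "\<tau> n \<in> {-\<epsilon><..<\<epsilon>}" using \<epsilon> by simp
  qed
  have \<tau>0: "\<tau> \<longlonglongrightarrow> 0" unfolding \<tau>_def using LIMSEQ_ignore_initial_segment[OF lim_const_over_n[of \<epsilon>], of 2] by simp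
  then have \<tau>_at: "filterlim \<tau> (at 0) sequentially"
    using \<tau> by (auto simp: filterlim_at intro!: always_eventually less_imp_neq[THEN not_sym])
  have E\<tau>: "(\<lambda>n. E (\<tau> n) x) \<longlonglongrightarrow> 0" if "x \<in> \<Omega>" for x
    by (rule filterlim_compose[OF E[OF that] \<tau>_at])
  have small: "\<forall>\<^sub>F n in sequentially. \<tau> n \<in> {-\<delta><..<\<delta>}" if "\<delta> > 0" for \<delta>
    using order_tendstoD(2)[OF \<tau>0 that]
  proof eventually_elim
    case (elim n)
    then show ?case using \<tau>(1)[of n] that by simp
  qed

  have "AE x in lebesgue_on \<Omega>. (S has_derivative (*v) (partial_t ?J 0 x)) (at x)"
  proof (rule AE_has_derivative_of_Linf_limit_matrix[OF \<Omega>(1)])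
    fix n
    define F where "F = (\<lambda>x. (1 / \<tau> n) *\<^sub>R (T (\<tau> n) x - x))"
    obtain L where "L-lipschitz_on \<Omega> (T (\<tau> n))" using Tlip[OF \<tau>(2)] by blast
    then have "(\<bar>1 / \<tau> n\<bar> * (L + 1))-lipschitz_on \<Omega> F"
      unfolding F_def by (intro lipschitz_on_cmult lipschitz_on_diff lipschitz_on_id)
    then show "\<exists>L. L-lipschitz_on \<Omega> (\<lambda>x. (1 / \<tau> n) *\<^sub>R (T (\<tau> n) x - x))" unfolding F_def ..
    show "AE x in lebesgue_on \<Omega>. ((\<lambda>x. (1 / \<tau> n) *\<^sub>R (T (\<tau> n) x - x)) has_derivative
        (*v) ((1 / \<tau> n) *\<^sub>R (?J (\<tau> n) x - mat 1))) (at x)"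
      using Tder[OF \<tau>(2)[of n]]
    proof eventually_elim
      case (elim x)
      have "((\<lambda>x. (1 / \<tau> n) *\<^sub>R (T (\<tau> n) x - x)) has_derivative
          (\<lambda>h. (1 / \<tau> n) *\<^sub>R (?J (\<tau> n) x *v h - h))) (at x)"
        by (intro derivative_intros elim)
      then show ?case
        by (rule has_derivative_eq_rhs) (simp add: fun_eq_iff matrix_vector_mult_diff_rdistrib scaleR_matrix_vector_assoc[symmetric])
    qed
  next
    fix e :: real assume e: "e > 0"
    obtain \<delta> where \<delta>: "\<delta> > 0" "AE x in lebesgue_on \<Omega>. \<forall>t\<in>{-\<delta><..<\<delta>}.
       norm (?J t x - ?J 0 x - t *\<^sub>R partial_t ?J 0 x) \<le> e * \<bar>t\<bar>"
      using C2_Linf_first_order[OF J \<epsilon> lm, of 0 e] e by auto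
    show "\<forall>\<^sub>F n in sequentially. AE x in lebesgue_on \<Omega>.
        norm ((1 / \<tau> n) *\<^sub>R (?J (\<tau> n) x - mat 1) - partial_t ?J 0 x) \<le> e"
      using small[OF \<delta>(1)]
    proof eventually_elim
      case (elim n)
      from \<delta>(2) AE_space show ?case
      proof eventually_elim
        case x: (elim x)
        have eq: "(1 / \<tau> n) *\<^sub>R (?J (\<tau> n) x - mat 1) - partial_t ?J 0 x
            = (1 / \<tau> n) *\<^sub>R (?J (\<tau> n) x - ?J 0 x - \<tau> n *\<^sub>R partial_t ?J 0 x)"
          using J0[of x] x(2) \<tau>(1)[of n] by (simp add: scaleR_diff_right)
        have "norm (?J (\<tau> n) x - ?J 0 x - \<tau> n *\<^sub>R partial_t ?J 0 x) \<le> e * \<tau> n"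
          using x(1)[rule_format, OF elim] \<tau>(1)[of n] by simp
        then show ?case unfolding eq using \<tau>(1)[of n] by (simp add: divide_simps)
      qed
    qed
  next
    fix x assume x: "x \<in> \<Omega>"
    have "(\<lambda>n. S x + (\<tau> n / 2) *\<^sub>R R x + \<tau> n *\<^sub>R E (\<tau> n) x) \<longlonglongrightarrow> S x + (0 / 2) *\<^sub>R R x + 0 *\<^sub>R 0"
      by (intro tendsto_intros \<tau>0 E\<tau>[OF x]) auto
    moreover have "(1 / \<tau> n) *\<^sub>R (T (\<tau> n) x - x) = S x + (\<tau> n / 2) *\<^sub>R R x + \<tau> n *\<^sub>R E (\<tau> n) x" for n
      using \<tau>(1)[of n] by (subst TE) (auto simp: scaleR_add_right power2_eq_square)
    ultimately show "(\<lambda>n. (1 / \<tau> n) *\<^sub>R (T (\<tau> n) x - x)) \<longlonglongrightarrow> S x" by simp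
  qed
  then have dS: "AE x in lebesgue_on \<Omega>. (S has_derivative (*v) (Jac S x)) (at x) \<and> Jac S x = partial_t ?J 0 x"
    by eventually_elim (simp add: Jac_eqI)
  then show "AE x in lebesgue_on \<Omega>. Jac S x = partial_t ?J 0 x" by eventually_elim simp

  have "AE x in lebesgue_on \<Omega>. (R has_derivative (*v) ((partial_t ^^ 2) ?J 0 x)) (at x)"
  proof (rule AE_has_derivative_of_Linf_limit_matrix[OF \<Omega>(1)])
    fix n
    define F where "F = (\<lambda>x. (2 / (\<tau> n)\<^sup>2) *\<^sub>R (T (\<tau> n) x - x - \<tau> n *\<^sub>R S x))"
    obtain L where "L-lipschitz_on \<Omega> (T (\<tau> n))" using Tlip[OF \<tau>(2)] by blast
    then have "(\<bar>2 / (\<tau> n)\<^sup>2\<bar> * (L + 1 + \<bar>\<tau> n\<bar> * L\<^sub>S))-lipschitz_on \<Omega> F"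
      unfolding F_def by (intro lipschitz_on_cmult lipschitz_on_diff lipschitz_on_id S)
    then show "\<exists>L. L-lipschitz_on \<Omega> (\<lambda>x. (2 / (\<tau> n)\<^sup>2) *\<^sub>R (T (\<tau> n) x - x - \<tau> n *\<^sub>R S x))" unfolding F_def ..
    show "AE x in lebesgue_on \<Omega>. ((\<lambda>x. (2 / (\<tau> n)\<^sup>2) *\<^sub>R (T (\<tau> n) x - x - \<tau> n *\<^sub>R S x)) has_derivative
        (*v) ((2 / (\<tau> n)\<^sup>2) *\<^sub>R (?J (\<tau> n) x - mat 1 - \<tau> n *\<^sub>R partial_t ?J 0 x))) (at x)"
      using Tder[OF \<tau>(2)[of n]] dS
    proof eventually_elim
      case (elim x)
      have "((\<lambda>x. (2 / (\<tau> n)\<^sup>2) *\<^sub>R (T (\<tau> n) x - x - \<tau> n *\<^sub>R S x)) has_derivative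
          (\<lambda>h. (2 / (\<tau> n)\<^sup>2) *\<^sub>R (?J (\<tau> n) x *v h - h - \<tau> n *\<^sub>R (Jac S x *v h)))) (at x)"
        using elim(2) by (intro derivative_intros elim(1)) auto
      then show ?case
        by (rule has_derivative_eq_rhs) (simp add: fun_eq_iff elim(2)[THEN conjunct2] matrix_vector_mult_diff_rdistrib scaleR_matrix_vector_assoc[symmetric])
    qed
  next
    fix e :: real assume e: "e > 0"
    then have "e / 2 > 0" by simp
    then obtain \<delta> where \<delta>: "\<delta> > 0" "AE x in lebesgue_on \<Omega>. \<forall>t\<in>{-\<delta><..<\<delta>}.
       norm (?J t x - ?J 0 x - t *\<^sub>R partial_t ?J 0 x - (t\<^sup>2 / 2) *\<^sub>R (partial_t ^^ 2) ?J 0 x) \<le> e / 2 * t\<^sup>2"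
      using C2_Linf_second_order[OF J \<epsilon> lm] by blast
    show "\<forall>\<^sub>F n in sequentially. AE x in lebesgue_on \<Omega>.
        norm ((2 / (\<tau> n)\<^sup>2) *\<^sub>R (?J (\<tau> n) x - mat 1 - \<tau> n *\<^sub>R partial_t ?J 0 x) - (partial_t ^^ 2) ?J 0 x) \<le> e"
      using small[OF \<delta>(1)]
    proof eventually_elim
      case (elim n)
      from \<delta>(2) AE_space show ?case
      proof eventually_elim
        case x: (elim x)
        define W where "W = ?J (\<tau> n) x - ?J 0 x - \<tau> n *\<^sub>R partial_t ?J 0 x - ((\<tau> n)\<^sup>2 / 2) *\<^sub>R (partial_t ^^ 2) ?J 0 x"
        have eq: "(2 / (\<tau> n)\<^sup>2) *\<^sub>R (?J (\<tau> n) x - mat 1 - \<tau> n *\<^sub>R partial_t ?J 0 x) - (partial_t ^^ 2) ?J 0 x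
            = (2 / (\<tau> n)\<^sup>2) *\<^sub>R W"
          using J0[of x] x(2) \<tau>(1)[of n] by (simp add: W_def scaleR_diff_right)
        have "norm W \<le> e / 2 * (\<tau> n)\<^sup>2" using x(1) elim unfolding W_def by blast
        then show ?case unfolding eq using \<tau>(1)[of n] by (simp add: divide_simps)
      qed
    qed
  next
    fix x assume x: "x \<in> \<Omega>"
    have "(\<lambda>n. R x + 2 *\<^sub>R E (\<tau> n) x) \<longlonglongrightarrow> R x + 2 *\<^sub>R 0"
      by (intro tendsto_intros E\<tau>[OF x])
    moreover have "(2 / (\<tau> n)\<^sup>2) *\<^sub>R (T (\<tau> n) x - x - \<tau> n *\<^sub>R S x) = R x + 2 *\<^sub>R E (\<tau> n) x" for n
      using \<tau>(1)[of n] by (subst TE) (auto simp: scaleR_add_right)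
    ultimately show "(\<lambda>n. (2 / (\<tau> n)\<^sup>2) *\<^sub>R (T (\<tau> n) x - x - \<tau> n *\<^sub>R S x)) \<longlonglongrightarrow> R x" by simp
  qed
  then show "AE x in lebesgue_on \<Omega>. Jac R x = (partial_t ^^ 2) ?J 0 x"
    by eventually_elim (simp add: Jac_eqI)
qed

section \<open>Matrix curves through the identity\<close>

lemma bounded_bilinear_matrix_matrix_mult:
  "bounded_bilinear ((**) :: real^'n^'m \<Rightarrow> real^'p^'n \<Rightarrow> real^'p^'m)"
  unfolding bilinear_conv_bounded_bilinear[symmetric] bilinear_def linear_iff
  by (simp add: matrix_matrix_mult_def vec_eq_iff sum.distrib sum_distrib_left algebra_simps)

lemma bounded_linear_transpose: "bounded_linear (transpose :: real^'n^'m \<Rightarrow> real^'m^'n)"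
  unfolding linear_conv_bounded_linear[symmetric] linear_iff
  by (simp add: transpose_def vec_eq_iff)

lemma bounded_linear_trace: "bounded_linear (trace :: real^'n^'n \<Rightarrow> real)"
  unfolding linear_conv_bounded_linear[symmetric] linear_iff
  by (simp add: trace_def sum.distrib sum_distrib_left)

lemma bounded_linear_bilin: "bounded_linear (\<lambda>G :: real^'n^'n. bilin G \<xi> \<eta>)"
  unfolding linear_conv_bounded_linear[symmetric] linear_iff
  by (simp add: bilin_def matrix_vector_mult_add_rdistrib inner_add_right scaleR_matrix_vector_assoc[symmetric])

lemmas has_vector_derivative_matrix_mult =
  bounded_bilinear.has_vector_derivative[OF bounded_bilinear_matrix_matrix_mult]

text \<open>
  In the derivative of the Leibniz expansion of \<open>det\<close> at the identity, one factor of each product is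
  differentiated and the others are entries of the identity matrix. A permutation that fixes all indices
  but one is the identity, so only the diagonal term survives.
\<close>

lemma prod_delta_permutes:
  fixes p :: "'n::finite \<Rightarrow> 'n"
  assumes p: "p permutes UNIV"
  shows "(\<Prod>j\<in>UNIV - {i}. (mat 1 :: real^'n^'n) $ j $ p j) = (if p = id then 1 else 0)"
proof (cases "p = id")
  case True then show ?thesis by (simp add: mat_def)
next
  case False
  then obtain j where j: "p j \<noteq> j" by (auto simp: fun_eq_iff)
  then have jj: "p (p j) \<noteq> p j" using permutes_inj[OF p] by (auto dest: injD)
  have "\<exists>l\<in>UNIV - {i}. (mat 1 :: real^'n^'n) $ l $ p l = 0"
  proof (cases "j = i")
    case True
    then show ?thesis using j jj by (intro bexI[of _ "p j"]) (auto simp: mat_def)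
  next
    case False
    then show ?thesis using j by (intro bexI[of _ j]) (auto simp: mat_def)
  qed
  then show ?thesis using False by (simp add: prod_zero)
qed

lemma has_vector_derivative_det_at_identity:
  fixes X :: "real \<Rightarrow> real^'n^'n"
  assumes X: "(X has_vector_derivative Y) (at t)" and Xt: "X t = mat 1"
  shows "((\<lambda>s. det (X s)) has_vector_derivative trace Y) (at t)"
proof -
  have entry: "((\<lambda>s. X s $ i $ j) has_real_derivative Y $ i $ j) (at t)" for i j
    unfolding has_real_derivative_iff_has_vector_derivative
    by (intro bounded_linear.has_vector_derivative[OF bounded_linear_vec_nth] X)
  have "((\<lambda>s. det (X s)) has_real_derivative
     (\<Sum>p\<in>{p. p permutes UNIV}. of_int (sign p) *
        (\<Sum>i\<in>UNIV. Y $ i $ p i * (\<Prod>j\<in>UNIV - {i}. X t $ j $ p j)))) (at t)"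
    unfolding det_def by (intro DERIV_sum DERIV_cmult has_field_derivative_prod entry)
  also have "(\<Sum>p\<in>{p. p permutes UNIV}. of_int (sign p) *
        (\<Sum>i\<in>UNIV. Y $ i $ p i * (\<Prod>j\<in>UNIV - {i}. X t $ j $ p j)))
     = (\<Sum>p\<in>{p. p permutes (UNIV :: 'n set)}. if p = id then trace Y else 0)"
    by (rule sum.cong[OF refl]) (auto simp: Xt prod_delta_permutes trace_def)
  also have "\<dots> = trace Y" by (simp add: finite_permutations permutes_id sum.delta')
  finally show ?thesis by (simp add: has_real_derivative_iff_has_vector_derivative)
qed

text \<open>
  Jacobi's formula. Multiplying the curve by the constant matrix \<open>Z\<close> moves it to the identity at
  time \<open>t\<close>, and \<open>det\<close> is multiplicative.
\<close>

lemma has_vector_derivative_det: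
  fixes X :: "real \<Rightarrow> real^'n^'n"
  assumes X: "(X has_vector_derivative Y) (at t)" and Z: "Z ** X t = mat 1"
  shows "((\<lambda>s. det (X s)) has_vector_derivative det (X t) * trace (Z ** Y)) (at t)"
proof -
  have "((\<lambda>s. Z ** X s) has_vector_derivative Z ** Y) (at t)"
    using has_vector_derivative_matrix_mult[OF has_vector_derivative_const X] by simp
  then have "((\<lambda>s. det (Z ** X s)) has_vector_derivative trace (Z ** Y)) (at t)"
    using Z by (rule has_vector_derivative_det_at_identity)
  from has_vector_derivative_mult[OF has_vector_derivative_const this, of "det (X t)"]
  have "((\<lambda>s. det (X t) * (det Z * det (X s))) has_vector_derivative det (X t) * trace (Z ** Y)) (at t)"
    by (simp add: det_mul)
  moreover have "det (X t) * (det Z * d) = d" for d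
  proof -
    have "det (X t) * det Z = 1" using Z by (metis det_I det_mul mult.commute)
    then show ?thesis by (simp add: mult.assoc[symmetric])
  qed
  ultimately show ?thesis by simp
qed

text \<open>
  The inverse curve is differentiable by hypothesis, so its derivatives can be read off from
  \<open>M N = E\<close>, which holds near \<open>0\<close> because \<open>det M\<close> stays away from zero there.
\<close>

lemma matrix_curve_near_identity:
  fixes M N :: "real \<Rightarrow> real^'n^'n"
  assumes \<epsilon>: "\<epsilon> > 0" and M0: "M 0 = mat 1" and NM: "\<And>s. N s = matrix_inv (M s)"
    and dM: "\<And>s. \<bar>s\<bar> < \<epsilon> \<Longrightarrow> (M has_vector_derivative M' s) (at s)"
    and d2M: "(M' has_vector_derivative R) (at 0)"
    and dN: "\<And>s. \<bar>s\<bar> < \<epsilon> \<Longrightarrow> (N has_vector_derivative N' s) (at s)"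
    and d2N: "(N' has_vector_derivative N2) (at 0)"
  obtains \<delta> where "0 < \<delta>" "\<delta> \<le> \<epsilon>" "\<And>s. \<bar>s\<bar> < \<delta> \<Longrightarrow> N s ** M s = mat 1"
    "N 0 = mat 1" "N' 0 = - M' 0" "N2 = 2 *\<^sub>R (M' 0 ** M' 0) - R"
proof -
  have "((\<lambda>s. det (M s)) has_vector_derivative trace (M' 0)) (at 0)"
    using \<epsilon> by (intro has_vector_derivative_det_at_identity dM M0) auto
  then have "isCont (\<lambda>s. det (M s)) 0" by (rule has_vector_derivative_continuous)
  then obtain \<delta>0 where \<delta>0: "\<delta>0 > 0" "\<And>s. \<bar>s\<bar> < \<delta>0 \<Longrightarrow> det (M s) \<noteq> 0"
    using continuous_at_avoid[of 0 "\<lambda>s. det (M s)" 0] M0 by (auto simp: dist_norm)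
  define \<delta> where "\<delta> = min \<delta>0 \<epsilon>"
  have \<delta>: "0 < \<delta>" "\<delta> \<le> \<epsilon>" using \<delta>0 \<epsilon> by (auto simp: \<delta>_def)
  have inv: "M s ** N s = mat 1 \<and> N s ** M s = mat 1" if "\<bar>s\<bar> < \<delta>" for s
  proof -
    have "invertible (M s)" using \<delta>0(2)[of s] that by (simp add: invertible_det_nz \<delta>_def)
    then show ?thesis unfolding NM matrix_inv_def invertible_def by (rule someI_ex)
  qed
  have N0: "N 0 = mat 1" using inv[of 0] \<delta> M0 by simp
  have P: "M s ** N' s + M' s ** N s = 0" if s: "\<bar>s\<bar> < \<delta>" for s
  proof -
    have "((\<lambda>s. M s ** N s) has_vector_derivative M s ** N' s + M' s ** N s) (at s)"
      using s \<delta> by (intro has_vector_derivative_matrix_mult dM dN) auto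
    moreover have "((\<lambda>s. M s ** N s) has_vector_derivative 0) (at s)"
      by (rule has_vector_derivative_transform_within_open[OF has_vector_derivative_const, of "{-\<delta><..<\<delta>}"])
        (use s inv in auto)
    ultimately show ?thesis by (rule vector_derivative_unique_at)
  qed
  have N1: "N' 0 = - M' 0" using P[of 0] \<delta> M0 N0 by (simp add: eq_neg_iff_add_eq_0)
  have "((\<lambda>s. M s ** N' s + M' s ** N s) has_vector_derivative
      (M 0 ** N2 + M' 0 ** N' 0) + (M' 0 ** N' 0 + R ** N 0)) (at 0)"
    using \<epsilon> by (intro has_vector_derivative_add has_vector_derivative_matrix_mult dM dN d2M d2N) auto
  moreover have "((\<lambda>s. M s ** N' s + M' s ** N s) has_vector_derivative 0) (at 0)"
    by (rule has_vector_derivative_transform_within_open[OF has_vector_derivative_const, of "{-\<delta><..<\<delta>}"])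
      (use \<delta> P in auto)
  ultimately have "(M 0 ** N2 + M' 0 ** N' 0) + (M' 0 ** N' 0 + R ** N 0) = 0"
    by (rule vector_derivative_unique_at)
  then have "N2 + (M' 0 ** N' 0 + (M' 0 ** N' 0 + R)) = 0" by (simp only: M0 N0 add.assoc matrix_mul_lid matrix_mul_rid)
  then have "N2 = - (M' 0 ** N' 0 + (M' 0 ** N' 0 + R))" by (simp only: eq_neg_iff_add_eq_0)
  moreover have "M' 0 ** N' 0 = - (M' 0 ** M' 0)"
    unfolding N1 by (rule bounded_bilinear.minus_right[OF bounded_bilinear_matrix_matrix_mult])
  ultimately have "N2 = 2 *\<^sub>R (M' 0 ** M' 0) - R"
    by (simp add: scaleR_2)
  with \<delta> inv N0 N1 show ?thesis by (intro that) auto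
qed

lemma partial_t_eqI:
  assumes \<delta>: "\<delta> > 0"
    and d: "\<And>s. \<bar>s\<bar> < \<delta> \<Longrightarrow> ((\<lambda>r. F r x) has_vector_derivative g s) (at s)"
    and g: "(g has_vector_derivative D) (at 0)"
  shows "partial_t F 0 x = g 0" "(partial_t ^^ 2) F 0 x = D"
proof -
  have eq: "partial_t F s x = g s" if "\<bar>s\<bar> < \<delta>" for s
    unfolding partial_t_def by (rule vector_derivative_at[OF d[OF that]])
  then show "partial_t F 0 x = g 0" using \<delta> by simp
  have "((\<lambda>s. partial_t F s x) has_vector_derivative D) (at 0)"
    by (rule has_vector_derivative_transform_within_open[OF g, of "{-\<delta><..<\<delta>}"]) (use \<delta> eq in auto)
  then show "(partial_t ^^ 2) F 0 x = D"
    unfolding numeral_2_eq_2 by (simp add: partial_t_def[of "partial_t F"] vector_derivative_at)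
qed

text \<open>
  Here \<open>F\<close> is the volume density and \<open>H\<close> the pulled-back Dirichlet integrand, as curves at one point
  \<open>x\<close>. The identity \<open>S\<^sup>T : S = trace (S\<^sup>2)\<close> turns the trace produced by Jacobi's formula into a
  Frobenius product.
\<close>

lemma partial_t_of_metric_and_volume:
  fixes M N :: "real \<Rightarrow> real^'n^'n"
  assumes \<epsilon>: "\<epsilon> > 0" and M0: "M 0 = mat 1" and NM: "\<And>s. N s = matrix_inv (M s)"
    and dM: "\<And>s. \<bar>s\<bar> < \<epsilon> \<Longrightarrow> (M has_vector_derivative M' s) (at s)"
    and d2M: "(M' has_vector_derivative R) (at 0)"
    and dN: "\<And>s. \<bar>s\<bar> < \<epsilon> \<Longrightarrow> (N has_vector_derivative N' s) (at s)"
    and d2N: "(N' has_vector_derivative N2) (at 0)"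
    and F: "\<And>s. F s x = det (M s)"
    and H: "\<And>s. H s x = bilin (N s ** transpose (N s)) \<xi> \<xi> * det (M s)"
  defines "S \<equiv> M' 0"
  defines "d2 \<equiv> trace R + (trace S)\<^sup>2 - frobenius (transpose S) S"
  shows "partial_t F 0 x = trace S" "(partial_t ^^ 2) F 0 x = d2"
    "partial_t H 0 x = bilin (- (transpose S + S) + trace S *\<^sub>R mat 1) \<xi> \<xi>"
    "(partial_t ^^ 2) H 0 x = bilin (transpose (2 *\<^sub>R (S ** S) - R) + (2 *\<^sub>R (S ** S) - R)
        + 2 *\<^sub>R (S ** transpose S) - (2 * trace S) *\<^sub>R (transpose S + S) + d2 *\<^sub>R mat 1) \<xi> \<xi>"
proof -
  interpret tr: bounded_linear "trace :: real^'n^'n \<Rightarrow> real" by (rule bounded_linear_trace)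
  interpret tp: bounded_linear "transpose :: real^'n^'n \<Rightarrow> real^'n^'n" by (rule bounded_linear_transpose)
  interpret bl: bounded_linear "\<lambda>G :: real^'n^'n. bilin G \<xi> \<xi>" by (rule bounded_linear_bilin)
  interpret mm: bounded_bilinear "(**) :: real^'n^'n \<Rightarrow> real^'n^'n \<Rightarrow> real^'n^'n"
    by (rule bounded_bilinear_matrix_matrix_mult)
  obtain \<delta> where \<delta>: "0 < \<delta>" "\<delta> \<le> \<epsilon>" and inv: "\<And>s. \<bar>s\<bar> < \<delta> \<Longrightarrow> N s ** M s = mat 1"
    and N0: "N 0 = mat 1" and N1: "N' 0 = - S" and N2: "N2 = 2 *\<^sub>R (S ** S) - R"
    using matrix_curve_near_identity[OF \<epsilon> M0 NM dM d2M dN d2N] unfolding S_def by metis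
  define a' where "a' s = det (M s) * trace (N s ** M' s)" for s
  have da: "((\<lambda>s. det (M s)) has_vector_derivative a' s) (at s)" if "\<bar>s\<bar> < \<delta>" for s
    unfolding a'_def using that \<delta> by (intro has_vector_derivative_det dM inv) auto
  have a0: "a' 0 = trace S" by (simp add: a'_def M0 N0 S_def)
  have fro: "frobenius (transpose S) S = trace (S ** S)"
    unfolding frobenius_def trace_def matrix_matrix_mult_def transpose_def
    by simp (subst sum.swap, rule refl)
  have "(a' has_vector_derivative det (M 0) * trace (N 0 ** R + N' 0 ** M' 0) + a' 0 * trace (N 0 ** M' 0)) (at 0)"
    unfolding a'_def[abs_def]
    by (rule has_vector_derivative_mult[OF da[unfolded a'_def] tr.has_vector_derivative[OF has_vector_derivative_matrix_mult]])
      (use \<delta> dN d2M in auto)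
  then have d2a: "(a' has_vector_derivative d2) (at 0)"
    by (rule has_vector_derivative_eq_rhs)
      (simp add: a0 M0 N0 N1 d2_def fro tr.add tr.diff tr.neg mm.minus_left power2_eq_square S_def[symmetric])
  show "partial_t F 0 x = trace S" "(partial_t ^^ 2) F 0 x = d2"
    using partial_t_eqI[of \<delta> F x a' d2] \<delta> da d2a by (auto simp: F a0)
  define Q where "Q s = N s ** transpose (N s)" for s
  define Q' where "Q' s = N s ** transpose (N' s) + N' s ** transpose (N s)" for s
  have dQ: "(Q has_vector_derivative Q' s) (at s)" if "\<bar>s\<bar> < \<delta>" for s
    unfolding Q_def[abs_def] Q'_def using that \<delta>
    by (intro has_vector_derivative_matrix_mult tp.has_vector_derivative dN) auto
  have "(Q' has_vector_derivative (N 0 ** transpose N2 + N' 0 ** transpose (N' 0))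
      + (N' 0 ** transpose (N' 0) + N2 ** transpose (N 0))) (at 0)"
    unfolding Q'_def[abs_def] using \<epsilon>
    by (intro has_vector_derivative_add has_vector_derivative_matrix_mult tp.has_vector_derivative dN d2N) auto
  then have d2Q: "(Q' has_vector_derivative transpose N2 + N2 + 2 *\<^sub>R (S ** transpose S)) (at 0)"
    by (rule has_vector_derivative_eq_rhs)
      (simp add: N0 N1 tp.neg mm.minus_left mm.minus_right scaleR_2)
  have Q0: "Q 0 = mat 1" "Q' 0 = - (transpose S + S)"
    by (simp_all add: Q_def Q'_def N0 N1 tp.neg)
  define b' where "b' s = bilin (Q s) \<xi> \<xi> * a' s + bilin (Q' s) \<xi> \<xi> * det (M s)" for s
  have db: "((\<lambda>r. H r x) has_vector_derivative b' s) (at s)" if "\<bar>s\<bar> < \<delta>" for s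
    unfolding H b'_def Q_def[symmetric] using that
    by (intro has_vector_derivative_mult bl.has_vector_derivative dQ da)
  have "(b' has_vector_derivative (bilin (Q 0) \<xi> \<xi> * d2 + bilin (Q' 0) \<xi> \<xi> * a' 0)
      + (bilin (Q' 0) \<xi> \<xi> * a' 0 + bilin (transpose N2 + N2 + 2 *\<^sub>R (S ** transpose S)) \<xi> \<xi> * det (M 0))) (at 0)"
    unfolding b'_def[abs_def] using \<delta>
    by (intro has_vector_derivative_add has_vector_derivative_mult bl.has_vector_derivative dQ da d2a d2Q) auto
  then have d2b: "(b' has_vector_derivative bilin (transpose N2 + N2 + 2 *\<^sub>R (S ** transpose S)
      - (2 * trace S) *\<^sub>R (transpose S + S) + d2 *\<^sub>R mat 1) \<xi> \<xi>) (at 0)"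
    by (rule has_vector_derivative_eq_rhs)
      (simp add: Q0 a0 M0 bl.add bl.diff bl.scaleR bl.neg algebra_simps)
  have b0: "b' 0 = bilin (- (transpose S + S) + trace S *\<^sub>R mat 1) \<xi> \<xi>"
    by (simp add: b'_def Q0 a0 M0 bl.add bl.diff bl.scaleR bl.neg algebra_simps)
  show "partial_t H 0 x = bilin (- (transpose S + S) + trace S *\<^sub>R mat 1) \<xi> \<xi>"
    "(partial_t ^^ 2) H 0 x = bilin (transpose (2 *\<^sub>R (S ** S) - R) + (2 *\<^sub>R (S ** S) - R)
        + 2 *\<^sub>R (S ** transpose S) - (2 * trace S) *\<^sub>R (transpose S + S) + d2 *\<^sub>R mat 1) \<xi> \<xi>"
    using partial_t_eqI[of \<delta> H x b', OF \<delta>(1) db d2b] unfolding b0 N2 by auto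
qed

section \<open>Derivatives of the bilinear forms\<close>

text \<open>
  Since Lebesgue measure is complete, \<open>f\<close> and \<open>g\<close> are both measurable or both not, and in the second case both integrals have the default value \<open>0\<close>.
\<close>

lemma integral_lebesgue_on_cong_AE:
  fixes f g :: "'a::euclidean_space \<Rightarrow> 'b::euclidean_space"
  assumes \<Omega>: "\<Omega> \<in> sets lebesgue" and eq: "AE x in lebesgue_on \<Omega>. f x = g x"
  shows "(LINT x|lebesgue_on \<Omega>. f x) = (LINT x|lebesgue_on \<Omega>. g x)"
proof -
  let ?f = "\<lambda>x. indicat_real \<Omega> x *\<^sub>R f x" and ?g = "\<lambda>x. indicat_real \<Omega> x *\<^sub>R g x"
  have "AE x in lebesgue. x \<in> \<Omega> \<longrightarrow> f x = g x"
    using eq \<Omega> by (simp add: AE_restrict_space_iff)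
  then have ae: "AE x in lebesgue. ?f x = ?g x" by eventually_elim (auto simp: indicator_def)
  then have ae': "AE x in lebesgue. ?g x = ?f x" by eventually_elim (rule sym)
  have "integral\<^sup>L lebesgue ?f = integral\<^sup>L lebesgue ?g"
  proof (cases "?f \<in> borel_measurable lebesgue")
    case True
    with borel_measurable_AE[OF True ae] ae show ?thesis by (intro integral_cong_AE)
  next
    case False
    moreover have "?g \<notin> borel_measurable lebesgue"
      using False borel_measurable_AE[OF _ ae'] by blast
    ultimately have "\<not> integrable lebesgue ?f" "\<not> integrable lebesgue ?g"
      using borel_measurable_integrable by blast+
    then show ?thesis by (simp add: not_integrable_integral_eq)
  qed
  then show ?thesis using \<Omega> by (simp add: integral_restrict_space)
qed

lemma C2_Linf_AE_has_vector_derivative: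
  assumes "C2_Linf \<epsilon> \<Omega> F" and \<epsilon>: "\<epsilon> > 0"
  shows "AE x in lebesgue_on \<Omega>.
      (\<forall>s. \<bar>s\<bar> < \<epsilon> \<longrightarrow> ((\<lambda>r. F r x) has_vector_derivative partial_t F s x) (at s)) \<and>
      ((\<lambda>r. partial_t F r x) has_vector_derivative (partial_t ^^ 2) F 0 x) (at 0)"
proof -
  have *: "AE x in lebesgue_on \<Omega>. \<forall>t\<in>{-\<epsilon><..<\<epsilon>}. (\<lambda>s. (partial_t ^^ l) F s x) differentiable (at t)"
    if "l < 2" for l :: nat
    using assms(1) that unfolding C2_Linf_def by blast
  have "(0::nat) < 2" "(1::nat) < 2" by simp_all
  from this[THEN *] show ?thesis
  proof eventually_elim
    case (elim x)
    have "((\<lambda>r. F r x) has_vector_derivative partial_t F s x) (at s)" if "\<bar>s\<bar> < \<epsilon>" for s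
    proof -
      have "s \<in> {-\<epsilon><..<\<epsilon>}" using that by auto
      with elim(1) show ?thesis unfolding partial_t_def by (simp add: vector_derivative_works[symmetric])
    qed
    moreover have "((\<lambda>r. partial_t F r x) has_vector_derivative partial_t (partial_t F) 0 x) (at 0)"
      using elim(2) \<epsilon> unfolding partial_t_def[of "partial_t F"]
      by (auto simp: vector_derivative_works[symmetric])
    ultimately show ?case by (simp add: numeral_2_eq_2)
  qed
qed

theorem theorem4:
  fixes \<Omega> \<gamma>\<^sub>0 \<gamma>\<^sub>1 :: "(real^'n) set"
    and T :: "real \<Rightarrow> real^'n \<Rightarrow> real^'n"
    and S R :: "real^'n \<Rightarrow> real^'n"
    and lam :: "real \<Rightarrow> nat \<Rightarrow> real"
    and u :: "real \<Rightarrow> nat \<Rightarrow> real^'n \<Rightarrow> real"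
    and \<phi> :: "real^'n \<Rightarrow> real"
    and \<epsilon>\<^sub>0 L\<^sub>S L\<^sub>R :: real
    and k :: nat
  assumes "CARD('n) \<ge> 2"
    and "bounded \<Omega>" and "lipschitz_domain \<Omega>"
    and "boundary_partition \<Omega> \<gamma>\<^sub>0 \<gamma>\<^sub>1"
    and "\<epsilon>\<^sub>0 > 0" and "C2_family \<epsilon>\<^sub>0 \<Omega> T"
    and "\<And>t. t \<in> {-\<epsilon>\<^sub>0<..<\<epsilon>\<^sub>0} \<Longrightarrow> eigensystem \<Omega> \<gamma>\<^sub>0 T t (lam t) (u t)"
    and "L\<^sub>S-lipschitz_on \<Omega> S" and "L\<^sub>R-lipschitz_on \<Omega> R"
    and "uniform_limit \<Omega>
           (\<lambda>t x. (1 / t\<^sup>2) *\<^sub>R (T t x - (x + t *\<^sub>R S x + (t\<^sup>2 / 2) *\<^sub>R R x))) (\<lambda>x. 0) (at 0)"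
    and "k \<ge> 1"
    and "k > 1 \<Longrightarrow> lam 0 (k - 1) < lam 0 k" and "lam 0 k < lam 0 (k + 1)"
    and "\<phi> = u 0 k"
  shows "A_dot \<Omega> T 0 \<phi> \<phi> =
           (LINT x|lebesgue_on \<Omega>.
              bilin (- (transpose (Jac S x) + Jac S x) + divergence S x *\<^sub>R mat 1)
                (grad \<Omega> \<phi> x) (grad \<Omega> \<phi> x))
       \<and> A_ddot \<Omega> T 0 \<phi> \<phi> =
           (LINT x|lebesgue_on \<Omega>.
              bilin (transpose (2 *\<^sub>R (Jac S x ** Jac S x) - Jac R x)
                     + (2 *\<^sub>R (Jac S x ** Jac S x) - Jac R x)
                     + 2 *\<^sub>R (Jac S x ** transpose (Jac S x))
                     - (2 * divergence S x) *\<^sub>R (transpose (Jac S x) + Jac S x)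
                     + (divergence R x + (divergence S x)\<^sup>2
                        - frobenius (transpose (Jac S x)) (Jac S x)) *\<^sub>R mat 1)
                (grad \<Omega> \<phi> x) (grad \<Omega> \<phi> x))
       \<and> B_dot \<Omega> T 0 \<phi> \<phi> = (LINT x|lebesgue_on \<Omega>. divergence S x * (\<phi> x)\<^sup>2)
       \<and> B_ddot \<Omega> T 0 \<phi> \<phi> =
           (LINT x|lebesgue_on \<Omega>.
              (divergence R x + (divergence S x)\<^sup>2
                 - frobenius (transpose (Jac S x)) (Jac S x)) * (\<phi> x)\<^sup>2)"
proof -
  have \<Omega>: "open \<Omega>" using assms(3) unfolding lipschitz_domain_def by blast
  then have \<Omega>s: "\<Omega> \<in> sets lebesgue" by simp
  note jac = AE_Jac_of_second_order_expansion[OF \<Omega> assms(2,5,6,8,10)]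
  have C2: "C2_Linf \<epsilon>\<^sub>0 \<Omega> (\<lambda>t x. Jac (T t) x)" "C2_Linf \<epsilon>\<^sub>0 \<Omega> (\<lambda>t x. matrix_inv (Jac (T t) x))"
    using assms(6) unfolding C2_family_def by blast+
  have "AE x in lebesgue_on \<Omega>.
      partial_t (vol T) 0 x = divergence S x \<and>
      (partial_t ^^ 2) (vol T) 0 x = divergence R x + (divergence S x)\<^sup>2
                        - frobenius (transpose (Jac S x)) (Jac S x) \<and>
      partial_t (A_integrand \<Omega> T \<phi> \<phi>) 0 x =
        bilin (- (transpose (Jac S x) + Jac S x) + divergence S x *\<^sub>R mat 1)
                (grad \<Omega> \<phi> x) (grad \<Omega> \<phi> x) \<and>
      (partial_t ^^ 2) (A_integrand \<Omega> T \<phi> \<phi>) 0 x =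
              bilin (transpose (2 *\<^sub>R (Jac S x ** Jac S x) - Jac R x)
                     + (2 *\<^sub>R (Jac S x ** Jac S x) - Jac R x)
                     + 2 *\<^sub>R (Jac S x ** transpose (Jac S x))
                     - (2 * divergence S x) *\<^sub>R (transpose (Jac S x) + Jac S x)
                     + (divergence R x + (divergence S x)\<^sup>2
                        - frobenius (transpose (Jac S x)) (Jac S x)) *\<^sub>R mat 1)
                (grad \<Omega> \<phi> x) (grad \<Omega> \<phi> x)"
    using jac(2,3) C2_Linf_AE_has_vector_derivative[OF C2(1) assms(5)]
      C2_Linf_AE_has_vector_derivative[OF C2(2) assms(5)] AE_space
  proof eventually_elim
    case (elim x)
    have "Jac (T 0) x = mat 1" using elim(5) by (intro jac(1)) simp
    note c = partial_t_of_metric_and_volume[of \<epsilon>\<^sub>0 "\<lambda>t. Jac (T t) x" "\<lambda>t. matrix_inv (Jac (T t) x)",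
      OF assms(5) this refl _ conjunct2[OF elim(3)] _ conjunct2[OF elim(4)], folded elim(1) elim(2)]
    show ?case
      unfolding divergence_def
      using c[of "vol T" x "A_integrand \<Omega> T \<phi> \<phi>" "grad \<Omega> \<phi> x"] elim(3,4)
      by (simp add: vol_def A_integrand_def Qmat_def)
  qed
  then have ae: 
    "AE x in lebesgue_on \<Omega>. partial_t (vol T) 0 x = divergence S x"
    "AE x in lebesgue_on \<Omega>. (partial_t ^^ 2) (vol T) 0 x = divergence R x + (divergence S x)\<^sup>2
                        - frobenius (transpose (Jac S x)) (Jac S x)"
    "AE x in lebesgue_on \<Omega>. partial_t (A_integrand \<Omega> T \<phi> \<phi>) 0 x =
        bilin (- (transpose (Jac S x) + Jac S x) + divergence S x *\<^sub>R mat 1)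
                (grad \<Omega> \<phi> x) (grad \<Omega> \<phi> x)"
    "AE x in lebesgue_on \<Omega>. (partial_t ^^ 2) (A_integrand \<Omega> T \<phi> \<phi>) 0 x =
              bilin (transpose (2 *\<^sub>R (Jac S x ** Jac S x) - Jac R x)
                     + (2 *\<^sub>R (Jac S x ** Jac S x) - Jac R x)
                     + 2 *\<^sub>R (Jac S x ** transpose (Jac S x))
                     - (2 * divergence S x) *\<^sub>R (transpose (Jac S x) + Jac S x)
                     + (divergence R x + (divergence S x)\<^sup>2
                        - frobenius (transpose (Jac S x)) (Jac S x)) *\<^sub>R mat 1)
                (grad \<Omega> \<phi> x) (grad \<Omega> \<phi> x)"
    unfolding AE_conj_iff by blast+
  show ?thesis
    unfolding A_dot_def A_ddot_def B_dot_def B_ddot_def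
  proof (intro conjI integral_lebesgue_on_cong_AE[OF \<Omega>s] ae(3) ae(4))
    show "AE x in lebesgue_on \<Omega>. \<phi> x * \<phi> x * partial_t (vol T) 0 x = divergence S x * (\<phi> x)\<^sup>2"
      using ae(1) by eventually_elim (simp add: power2_eq_square)
    show "AE x in lebesgue_on \<Omega>. \<phi> x * \<phi> x * (partial_t ^^ 2) (vol T) 0 x =
        (divergence R x + (divergence S x)\<^sup>2 - frobenius (transpose (Jac S x)) (Jac S x)) * (\<phi> x)\<^sup>2"
      using ae(2) by eventually_elim (simp add: power2_eq_square)
  qed
qed

end
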